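(* Let $A:[0,1]\to[0,1]$ satisfy the standing assumption on $A$ stated in the context, let $\hat A$ be its concave hull, and let $\beta_c=\sqrt{2\log 2}/\sqrt{\hat A'(0)}$. Let $0\le \beta<\beta_c$. Then for all $s>0$ there exist $N_0=N_0(A,\beta,s)\in\mathbb N$ and a constant $C=C(A,\beta,s)>0$, independent of $N$, such that for all $N\ge N_0$, $$\mathbb E\big[(Z_{\beta,N})^{-s}\big]\le C\,\mathbb E\big[Z_{\beta,N}\big]^{-s},$$ where $Z_{\beta,N}$ is the partition function of the continuous random energy model (CREM) of depth $N$ with covariance profile $A$.
   Context: Standing assumption on $A$: $A$ is a non-decreasing function on $[0,1]$ with $A(0)=0$ and $A(1)=1$. Let $\hat A$ be the concave hull of $A$ (the smallest concave function on $[0,1]$ with $\hat A\ge A$) and $\hat A'$ its right derivative. It is assumed that: (i) there is $x_0\in(0,1]$ such that $A$ is differentiable on $(0,x_0)$, and $A$ has a finite right derivative at $0$ (denoted $A'(0)$); (ii) there exist $\alpha\in(0,1)$ and $x_1\in(0,1]$ such that $A'$ is defined on $[0,x_1]$ and $\sup_{x,y\in[0,x_1],\,x\ne y}\frac{|A'(x)-A'(y)|}{|x-y|^\alpha}<\infty$; (iii) $\hat A'(0)<\infty$. The CREM: for $N\in\mathbb N$, $\mathbb T_N$ is the rooted binary tree of depth $N$ (every vertex of depth less than $N$ has exactly two children), $|u|$ is the depth of a vertex $u$, and $u\wedge v$ is the most recent common ancestor of $u$ and $v$. The CREM is the centered Gaussian process $(X_u)_{u\in\mathbb T_N}$ with $\mathbb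 E[X_vX_w]=N\,A(|v\wedge w|/N)$ for all $v,w\in\mathbb T_N$. Its partition function at inverse temperature $\beta$ is $Z_{\beta,N}=\sum_{|u|=N}e^{\beta X_u}$. *)

theory Defs
  imports "HOL-Probability.Probability" "HOL-Library.Sublist"
begin

section \<open>The covariance profile\<close>

text \<open>Profiles are functions on the real line of which only the values on the unit interval
  matter.\<close>

definition concave_hull :: "(real \<Rightarrow> real) \<Rightarrow> real \<Rightarrow> real" where
  "concave_hull A x =
     Inf {g x | g. concave_on {0..1} g \<and> (\<forall>y\<in>{0..1}. A y \<le> g y)}"

text \<open>Since \<open>Inf\<close> is the conditionally complete infimum on the reals, we check that
  for bounded \<open>A\<close> this is indeed the smallest concave majorant.\<close>

lemma concave_hull_le:
  assumes "concave_on {0..1} g" "\<forall>y\<in>{0..1}. A y \<le> g y" "x \<in> {0..1}"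
  shows "concave_hull A x \<le> g x"
  unfolding concave_hull_def
  by (rule cInf_lower) (use assms in \<open>auto intro!: bdd_belowI[of _ "A x"]\<close>)

lemma le_concave_hull:
  assumes "\<forall>y\<in>{0..1}. A y \<le> B"
    and "\<And>g. concave_on {0..1} g \<Longrightarrow> \<forall>y\<in>{0..1}. A y \<le> g y \<Longrightarrow> c \<le> g x"
  shows "c \<le> concave_hull A x"
proof -
  have "concave_on {0..1::real} (\<lambda>_. B)"
    by (simp add: concave_on_def convex_on_const)
  then show ?thesis
    unfolding concave_hull_def using assms by (intro cInf_greatest) auto
qed

lemma concave_hull_majorant:
  assumes "\<forall>y\<in>{0..1}. A y \<le> B" "x \<in> {0..1}"
  shows "A x \<le> concave_hull A x"
  using assms by (intro le_concave_hull) auto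

lemma concave_on_concave_hull:
  assumes "\<forall>y\<in>{0..1}. A y \<le> B"
  shows "concave_on {0..1} (concave_hull A)"
  unfolding concave_on_iff
proof (intro conjI ballI allI impI)
  fix x y u v :: real
  assume *: "x \<in> {0..1}" "y \<in> {0..1}" "0 \<le> u" "0 \<le> v" "u + v = 1"
  show "u * concave_hull A x + v * concave_hull A y
          \<le> concave_hull A (u *\<^sub>R x + v *\<^sub>R y)"
  proof (rule le_concave_hull[OF assms])
    fix g assume g: "concave_on {0..1} g" "\<forall>y\<in>{0..1}. A y \<le> g y"
    have "u * concave_hull A x + v * concave_hull A y \<le> u * g x + v * g y"
      using * g by (intro add_mono mult_left_mono concave_hull_le) auto
    also have "\<dots> \<le> g (u *\<^sub>R x + v *\<^sub>R y)"
      using g(1) * by (auto simp: concave_on_iff)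
    finally show "u * concave_hull A x + v * concave_hull A y \<le> g (u *\<^sub>R x + v *\<^sub>R y)" .
  qed
qed simp

definition right_deriv :: "(real \<Rightarrow> real) \<Rightarrow> real \<Rightarrow> real" where
  "right_deriv f x = vector_derivative f (at_right x)"

text \<open>In the Hoelder condition, \<open>A'\<close> is the derivative relative to the unit interval: the
  right derivative at 0, the two-sided derivative at interior points, the left derivative at 1.\<close>

definition holder_deriv_near_0 :: "(real \<Rightarrow> real) \<Rightarrow> bool" where
  "holder_deriv_near_0 A \<longleftrightarrow>
     (\<exists>\<alpha>\<in>{0<..<1}. \<exists>x1\<in>{0<..1}. \<exists>A'.
        (\<forall>x\<in>{0..x1}. (A has_real_derivative A' x) (at x within {0..1})) \<and>
        bdd_above {\<bar>A' x - A' y\<bar> / \<bar>x - y\<bar> powr \<alpha> | x y.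
                     x \<in> {0..x1} \<and> y \<in> {0..x1} \<and> x \<noteq> y})"

text \<open>The last conjunct says that the right derivative of the hull at 0 is finite: by concavity
  the difference quotient always has a limit in \<open>(-\<infinity>, \<infinity>]\<close>.\<close>

definition covariance_profile :: "(real \<Rightarrow> real) \<Rightarrow> bool" where
  "covariance_profile A \<longleftrightarrow>
     mono_on {0..1} A \<and> A 0 = 0 \<and> A 1 = 1 \<and>
     (\<exists>x0\<in>{0<..1}. A differentiable_on {0<..<x0}) \<and> A differentiable (at_right 0) \<and>
     holder_deriv_near_0 A \<and>
     concave_hull A differentiable (at_right 0)"

definition critical_beta :: "(real \<Rightarrow> real) \<Rightarrow> real" where
  "critical_beta A = sqrt (2 * ln 2) / sqrt (right_deriv (concave_hull A) 0)"


section \<open>Gaussian processes\<close>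

text \<open>Degenerate (almost surely constant) variables count as Gaussian.\<close>

definition gaussian_rv :: "'w measure \<Rightarrow> ('w \<Rightarrow> real) \<Rightarrow> bool" where
  "gaussian_rv M Y \<longleftrightarrow>
     Y \<in> borel_measurable M \<and>
     ((\<exists>\<mu> \<sigma>. 0 < \<sigma> \<and> distributed M lborel Y (\<lambda>x. ennreal (normal_density \<mu> \<sigma> x))) \<or>
      (\<exists>\<mu>. AE \<omega> in M. Y \<omega> = \<mu>))"

definition gaussian_process :: "'w measure \<Rightarrow> 'i set \<Rightarrow> ('i \<Rightarrow> 'w \<Rightarrow> real) \<Rightarrow> bool" where
  "gaussian_process M I X \<longleftrightarrow>
     prob_space M \<and>
     (\<forall>J c. finite J \<and> J \<subseteq> I \<longrightarrow> gaussian_rv M (\<lambda>\<omega>. \<Sum>i\<in>J. c i * X i \<omega>))"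

definition centered_gaussian_process ::
  "'w measure \<Rightarrow> 'i set \<Rightarrow> ('i \<Rightarrow> 'w \<Rightarrow> real) \<Rightarrow> bool" where
  "centered_gaussian_process M I X \<longleftrightarrow>
     gaussian_process M I X \<and> (\<forall>i\<in>I. prob_space.expectation M (X i) = 0)"


section \<open>The continuous random energy model\<close>

text \<open>A vertex of the binary tree is the list of left/right choices on the path from the root
  to it, so its depth is the length of the list, and the most recent common ancestor of two
  vertices is their longest common prefix.\<close>

type_synonym vertex = "bool list"

definition binary_tree :: "nat \<Rightarrow> vertex set" where
  "binary_tree N = {u. length u \<le> N}"

abbreviation mrca :: "vertex \<Rightarrow> vertex \<Rightarrow> vertex" where
  "mrca \<equiv> longest_common_prefix"

definition crem ::
  "(real \<Rightarrow> real) \<Rightarrow> nat \<Rightarrow> 'w measure \<Rightarrow> (vertex \<Rightarrow> 'w \<Rightarrow> real) \<Rightarrow> bool" where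
  "crem A N M X \<longleftrightarrow>
     centered_gaussian_process M (binary_tree N) X \<and>
     (\<forall>v\<in>binary_tree N. \<forall>w\<in>binary_tree N.
        prob_space.expectation M (\<lambda>\<omega>. X v \<omega> * X w \<omega>)
          = real N * A (real (length (mrca v w)) / real N))"

definition partition_function ::
  "(vertex \<Rightarrow> 'w \<Rightarrow> real) \<Rightarrow> real \<Rightarrow> nat \<Rightarrow> 'w \<Rightarrow> real" where
  "partition_function X \<beta> N \<omega> = (\<Sum>u | length u = N. exp (\<beta> * X u \<omega>))"

end

theory Submission
  imports Defs
begin

text \<open>The increments of the process along the edges of the tree are independent Gaussians, so
  \<open>W = Z / E Z\<close> satisfies \<open>W\<^sub>u = (\<xi>\<^sub>0 W\<^sub>u\<^sub>0 + \<xi>\<^sub>1 W\<^sub>u\<^sub>1) / 2\<close> with independent summands and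
  log-normal weights of mean one. Only two consequences of the hypotheses matter: near 0 the
  increments of \<open>A\<close> are at most \<open>K' (y - x)\<close> with \<open>\<beta>\<^sup>2 K' < 2 ln 2\<close>, and \<open>A\<close> is bounded.

  The recursion bounds \<open>E W\<^sub>u\<^sup>p\<close> for \<open>p\<close> slightly above 1 uniformly over the vertices \<open>u\<close> of
  depth at most \<open>\<delta> N\<close>, hence \<open>\<xi>\<^sub>u W\<^sub>u \<ge> 1/2\<close> with probability at least \<open>c > 0\<close>. For a small
  exponent \<open>s\<close> one uses the first child if \<open>\<xi>\<^sub>0 W\<^sub>u\<^sub>0 \<ge> 1/2\<close> and the second child otherwise, which
  gives \<open>E W\<^sub>u\<^sup>-\<^sup>s \<le> 4\<^sup>s + \<rho> E W\<^sub>u\<^sub>1\<^sup>-\<^sup>s\<close> with \<open>\<rho> < 1\<close>. Iterated \<open>\<delta> N / 2\<close> times, the contraction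
  beats the trivial bound \<open>exp (O(s N))\<close> on the last term. Finally
  \<open>W\<^sub>u\<^sup>2 \<ge> \<xi>\<^sub>0 W\<^sub>u\<^sub>0 \<xi>\<^sub>1 W\<^sub>u\<^sub>1\<close> doubles the exponent at the cost of one generation, and finitely
  many doublings reach any \<open>s\<close>.\<close>

section \<open>Independence from characteristic functions\<close>

text \<open>Levy's uniqueness theorem is one-dimensional. Reweighting the probability by \<open>2 + cos S\<close> and
  \<open>2 + sin S\<close> reduces the joint law of \<open>X\<close> and \<open>S\<close> to it.\<close>

lemma (in prob_space) tilted_measure_eq:
  fixes X h :: "'a \<Rightarrow> real"
  assumes [measurable]: "X \<in> borel_measurable M" "h \<in> borel_measurable M"
    and h: "\<And>\<omega>. 1 \<le> h \<omega>" "\<And>\<omega>. h \<omega> \<le> K"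
    and \<mu>: "real_distribution \<mu>"
    and cf: "\<And>\<tau>. (CLINT \<omega>|M. complex_of_real (h \<omega>) * iexp (\<tau> * X \<omega>)) = char \<mu> \<tau> * expectation h"
    and B [measurable]: "B \<in> sets borel"
  shows "(LINT \<omega>|M. h \<omega> * indicator B (X \<omega>)) = measure \<mu> B * expectation h"
proof -
  define c where "c = expectation h"
  have int_h: "integrable M h"
    by (rule integrable_const_bound[where B=K])
      (use h order_trans[OF zero_le_one h(1)] in auto)
  have "(LINT \<omega>|M. 1) \<le> c"
    unfolding c_def by (rule integral_mono) (use h int_h in auto)
  then have c: "1 \<le> c" by (simp add: prob_space)
  \<comment> \<open>As \<open>h\<close> lies between 1 and \<open>K\<close>, \<open>h / c\<close> is
    a probability density. Divided by \<open>c\<close>, the hypothesis \<open>cf\<close> says that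
    \<open>X\<close> has characteristic function \<open>char \<mu>\<close> under
    \<open>N\<close>.\<close>
  define N where "N = density M (\<lambda>\<omega>. ennreal (h \<omega> / c))"
  have hc: "0 \<le> h \<omega> / c" for \<omega> using c h(1)[of \<omega>] by simp
  have int_hc: "integrable M (\<lambda>\<omega>. h \<omega> / c)" using int_h by simp
  interpret N: prob_space N
  proof
    have "emeasure N (space N) = (\<integral>\<^sup>+\<omega>. ennreal (h \<omega> / c) \<partial>M)"
      unfolding N_def by (subst emeasure_density) (auto intro!: nn_integral_cong)
    also have "\<dots> = ennreal (LINT \<omega>|M. h \<omega> / c)"
      by (rule nn_integral_eq_integral) (use int_hc hc in auto)
    also have "(LINT \<omega>|M. h \<omega> / c) = 1"
      using c by (simp flip: c_def)
    finally show "emeasure N (space N) = 1" by simp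
  qed
  have XN [measurable]: "X \<in> borel_measurable N" by (simp add: N_def)
  have D: "real_distribution (distr N borel X)"
    by (rule N.real_distribution_distr) simp
  have "char (distr N borel X) = char \<mu>"
  proof
    fix \<tau>
    have "char (distr N borel X) \<tau> = (CLINT \<omega>|N. iexp (\<tau> * X \<omega>))"
      unfolding char_def by (subst integral_distr) auto
    also have "\<dots> = (CLINT \<omega>|M. (h \<omega> / c) *\<^sub>R iexp (\<tau> * X \<omega>))"
      unfolding N_def by (subst integral_density) (use hc in auto)
    also have "\<dots> = (CLINT \<omega>|M. (complex_of_real (h \<omega>) * iexp (\<tau> * X \<omega>)) / c)"
      by (intro Bochner_Integration.integral_cong) (auto simp: scaleR_conv_of_real)
    also have "\<dots> = char \<mu> \<tau>"
      using c cf by (subst integral_divide_zero) (simp add: c_def)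
    finally show "char (distr N borel X) \<tau> = char \<mu> \<tau>" .
  qed
  then have eq: "distr N borel X = \<mu>"
    by (rule Levy_uniqueness[OF D \<mu>])
  have "measure \<mu> B = measure N (X -` B \<inter> space N)"
    unfolding eq[symmetric]
    by (subst measure_distr) simp_all
  also have "measure N (X -` B \<inter> space N) = (LINT \<omega>|N. indicator (X -` B \<inter> space N) \<omega>)"
    by simp
  also have "\<dots> = (LINT \<omega>|N. indicator B (X \<omega>))"
    by (intro Bochner_Integration.integral_cong) (auto split: split_indicator)
  also have "\<dots> = (LINT \<omega>|M. (h \<omega> * indicator B (X \<omega>)) / c)"
    unfolding N_def by (subst integral_real_density) (use hc in auto)
  also have "\<dots> = (LINT \<omega>|M. h \<omega> * indicator B (X \<omega>)) / c" by simp
  finally show ?thesis using c by (simp add: c_def field_simps)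
qed

text \<open>The hypothesis enters at r = 0, 1, -1: cos S and sin S are linear combinations of
  exp(iS) and exp(-iS), so the tilts 2 + cos S and 2 + sin S, with values between 1 and 3, are
  admissible in \<open>tilted_measure_eq\<close>. Subtracting twice the untilted identity and
  recombining by Euler's formula gives the claim.\<close>

lemma (in prob_space) char_split_imp_indep:
  fixes X S :: "'a \<Rightarrow> real"
  assumes [measurable]: "X \<in> borel_measurable M" "S \<in> borel_measurable M"
    and \<mu>: "real_distribution \<mu>"
    and cf: "\<And>\<tau> r. (CLINT \<omega>|M. iexp (\<tau> * X \<omega> + r * S \<omega>)) = char \<mu> \<tau> * (CLINT \<omega>|M. iexp (r * S \<omega>))"
    and B [measurable]: "B \<in> sets borel"
  shows "(CLINT \<omega>|M. indicator B (X \<omega>) *\<^sub>R iexp (S \<omega>)) = measure \<mu> B * (CLINT \<omega>|M. iexp (S \<omega>))"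
proof -
  have int1: "integrable M (\<lambda>\<omega>. iexp (\<tau> * X \<omega> + r * S \<omega>))" for \<tau> r
    by (rule integrable_iexp) auto
  have int0: "integrable M (\<lambda>\<omega>. iexp (\<tau> * X \<omega>))" for \<tau>
    by (rule integrable_iexp) auto
  have intS: "integrable M (\<lambda>\<omega>. iexp (r * S \<omega>))" for r
    by (rule integrable_iexp) auto
  have cf0: "(CLINT \<omega>|M. iexp (\<tau> * X \<omega>)) = char \<mu> \<tau>" for \<tau>
    using cf[of \<tau> 0] by (simp add: prob_space)
  have cosS: "complex_of_real (cos x) = (iexp (1 * x) + iexp ((-1) * x)) / 2" for x
    by (simp only: cos_of_real[symmetric] cos_exp_eq) simp
  have sinS: "complex_of_real (sin x) = (iexp (1 * x) - iexp ((-1) * x)) / (2 * \<i>)" for x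
    by (simp only: sin_of_real[symmetric] sin_exp_eq) simp
  have intc: "integrable M (\<lambda>\<omega>. cos (S \<omega>))" "integrable M (\<lambda>\<omega>. sin (S \<omega>))"
    by (auto intro!: integrable_const_bound[where B=1])
  have Ec: "complex_of_real (LINT \<omega>|M. cos (S \<omega>)) = ((CLINT \<omega>|M. iexp (1 * S \<omega>)) + (CLINT \<omega>|M. iexp ((-1) * S \<omega>))) / 2"
    unfolding integral_complex_of_real[symmetric] cosS using intS[of 1] intS[of "-1"] by simp
  have Es: "complex_of_real (LINT \<omega>|M. sin (S \<omega>)) = ((CLINT \<omega>|M. iexp (1 * S \<omega>)) - (CLINT \<omega>|M. iexp ((-1) * S \<omega>))) / (2 * \<i>)"
    unfolding integral_complex_of_real[symmetric] sinS using intS[of 1] intS[of "-1"] by simp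
  have split: "iexp (r * S \<omega>) * iexp (\<tau> * X \<omega>) = iexp (\<tau> * X \<omega> + r * S \<omega>)" for r \<tau> \<omega>
    by (simp add: exp_add[symmetric] algebra_simps)
  have 1: "(LINT \<omega>|M. 1 * indicator B (X \<omega>)) = measure \<mu> B * expectation (\<lambda>_. 1)"
    by (rule tilted_measure_eq[where K=1]) (use \<mu> cf0 in \<open>auto simp: prob_space\<close>)
  have c: "(LINT \<omega>|M. (2 + cos (S \<omega>)) * indicator B (X \<omega>)) = measure \<mu> B * expectation (\<lambda>\<omega>. 2 + cos (S \<omega>))"
  proof (rule tilted_measure_eq[where K=3])
    fix \<tau>
    have "complex_of_real (2 + cos (S \<omega>)) * iexp (\<tau> * X \<omega>) =
        2 * iexp (\<tau> * X \<omega>) + (iexp (\<tau> * X \<omega> + 1 * S \<omega>) + iexp (\<tau> * X \<omega> + (-1) * S \<omega>)) / 2" for \<omega>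
      unfolding split[symmetric] unfolding of_real_add cosS by (simp add: algebra_simps add_divide_distrib)
    then have "(CLINT \<omega>|M. complex_of_real (2 + cos (S \<omega>)) * iexp (\<tau> * X \<omega>)) =
       2 * char \<mu> \<tau> + char \<mu> \<tau> * complex_of_real (LINT \<omega>|M. cos (S \<omega>))"
      using int1[of \<tau> 1] int1[of \<tau> "-1"] int0[of \<tau>] cf[of \<tau> 1] cf[of \<tau> "-1"] cf0[of \<tau>]
      by (simp only: Ec) (simp add: algebra_simps add_divide_distrib)
    then show "(CLINT \<omega>|M. complex_of_real (2 + cos (S \<omega>)) * iexp (\<tau> * X \<omega>)) =
       char \<mu> \<tau> * complex_of_real (LINT \<omega>|M. 2 + cos (S \<omega>))"
      using intc by (simp add: algebra_simps prob_space)
  qed (use \<mu> in \<open>auto simp: add_increasing2 intro: order_trans[OF _ add_left_mono[OF cos_ge_minus_one]]\<close>)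
  have s: "(LINT \<omega>|M. (2 + sin (S \<omega>)) * indicator B (X \<omega>)) = measure \<mu> B * expectation (\<lambda>\<omega>. 2 + sin (S \<omega>))"
  proof (rule tilted_measure_eq[where K=3])
    fix \<tau>
    have "complex_of_real (2 + sin (S \<omega>)) * iexp (\<tau> * X \<omega>) =
        2 * iexp (\<tau> * X \<omega>) + (iexp (\<tau> * X \<omega> + 1 * S \<omega>) - iexp (\<tau> * X \<omega> + (-1) * S \<omega>)) / (2 * \<i>)" for \<omega>
      unfolding split[symmetric] unfolding of_real_add sinS by (simp add: algebra_simps add_divide_distrib diff_divide_distrib)
    then have "(CLINT \<omega>|M. complex_of_real (2 + sin (S \<omega>)) * iexp (\<tau> * X \<omega>)) =
       2 * char \<mu> \<tau> + char \<mu> \<tau> * complex_of_real (LINT \<omega>|M. sin (S \<omega>))"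
      using int1[of \<tau> 1] int1[of \<tau> "-1"] int0[of \<tau>] cf[of \<tau> 1] cf[of \<tau> "-1"] cf0[of \<tau>]
      by (simp only: Es) (simp add: algebra_simps add_divide_distrib diff_divide_distrib)
    then show "(CLINT \<omega>|M. complex_of_real (2 + sin (S \<omega>)) * iexp (\<tau> * X \<omega>)) =
       char \<mu> \<tau> * complex_of_real (LINT \<omega>|M. 2 + sin (S \<omega>))"
      using intc by (simp add: algebra_simps prob_space)
  qed (use \<mu> in \<open>auto simp: add_increasing2 intro: order_trans[OF _ add_left_mono[OF sin_ge_minus_one]]\<close>)
  have i1: "integrable M (\<lambda>\<omega>. indicator B (X \<omega>) :: real)"
    by (auto intro!: integrable_const_bound[where B=1])
  have ic: "integrable M (\<lambda>\<omega>. cos (S \<omega>) * indicator B (X \<omega>))"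
    and is': "integrable M (\<lambda>\<omega>. sin (S \<omega>) * indicator B (X \<omega>))"
    by (auto intro!: integrable_const_bound[where B=1] simp: indicator_def)
  have c': "(LINT \<omega>|M. cos (S \<omega>) * indicator B (X \<omega>)) = measure \<mu> B * (LINT \<omega>|M. cos (S \<omega>))"
    using c 1 i1 ic intc by (simp add: algebra_simps prob_space)
  have s': "(LINT \<omega>|M. sin (S \<omega>) * indicator B (X \<omega>)) = measure \<mu> B * (LINT \<omega>|M. sin (S \<omega>))"
    using s 1 i1 is' intc by (simp add: algebra_simps prob_space)
  have "(CLINT \<omega>|M. indicator B (X \<omega>) *\<^sub>R iexp (S \<omega>)) =
    (CLINT \<omega>|M. complex_of_real (cos (S \<omega>) * indicator B (X \<omega>)) + \<i> * complex_of_real (sin (S \<omega>) * indicator B (X \<omega>)))"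
    by (intro Bochner_Integration.integral_cong) (auto simp: scaleR_conv_of_real exp_Euler cos_of_real sin_of_real algebra_simps)
  also have "\<dots> = complex_of_real (LINT \<omega>|M. cos (S \<omega>) * indicator B (X \<omega>)) + \<i> * complex_of_real (LINT \<omega>|M. sin (S \<omega>) * indicator B (X \<omega>))"
    using ic is' unfolding integral_complex_of_real[symmetric] 
    by (subst Bochner_Integration.integral_add) (auto simp del: of_real_mult intro!: integrable_mult_right)
  also have "\<dots> = measure \<mu> B * (complex_of_real (LINT \<omega>|M. cos (S \<omega>)) + \<i> * complex_of_real (LINT \<omega>|M. sin (S \<omega>)))"
    unfolding c' s' by (simp add: algebra_simps)
  also have "complex_of_real (LINT \<omega>|M. cos (S \<omega>)) + \<i> * complex_of_real (LINT \<omega>|M. sin (S \<omega>)) = (CLINT \<omega>|M. iexp (S \<omega>))"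
    unfolding Ec Es by (simp add: field_simps)
  finally show ?thesis .
qed

text \<open>Induction by conditioning: given that \<open>X j\<close> lies in \<open>B j\<close>, the
  remaining variables keep their product characteristic function, by
  \<open>char_split_imp_indep\<close> applied to a linear combination of them. The induction
  therefore generalises over \<open>M\<close> while the target laws \<open>\<mu>\<close> stay
  fixed.\<close>

lemma char_prod_imp_prob_prod:
  fixes X :: "'i \<Rightarrow> 'a \<Rightarrow> real" and \<mu> :: "'i \<Rightarrow> real measure"
  assumes "finite I"
  shows "\<lbrakk>prob_space M; \<And>i. i \<in> I \<Longrightarrow> X i \<in> borel_measurable M; \<And>i. i \<in> I \<Longrightarrow> real_distribution (\<mu> i);
    \<And>t. (CLINT \<omega>|M. iexp (\<Sum>i\<in>I. t i * X i \<omega>)) = (\<Prod>i\<in>I. char (\<mu> i) (t i));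
    \<And>i. i \<in> I \<Longrightarrow> B i \<in> sets borel\<rbrakk>
    \<Longrightarrow> (LINT \<omega>|M. (\<Prod>i\<in>I. indicator (B i) (X i \<omega>))) = (\<Prod>i\<in>I. measure (\<mu> i) (B i))"
  using assms
proof (induction I arbitrary: M rule: finite_induct)
  case empty
  then interpret prob_space M by simp
  show ?case by (simp add: prob_space)
next
  case (insert j I)
  interpret prob_space M by fact
  have [measurable]: "X j \<in> borel_measurable M" "B j \<in> sets borel"
    and [measurable]: "\<And>i. i \<in> I \<Longrightarrow> X i \<in> borel_measurable M" "\<And>i. i \<in> I \<Longrightarrow> B i \<in> sets borel"
    using insert.prems by auto
  have \<mu>j: "real_distribution (\<mu> j)" using insert.prems by auto
  \<comment> \<open>Setting coordinate \<open>j\<close> of \<open>t\<close> to 0 removes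
    \<open>X j\<close>, since a characteristic function is 1 at 0.\<close>
  have cfI: "(CLINT \<omega>|M. iexp (\<Sum>i\<in>I. t i * X i \<omega>)) = (\<Prod>i\<in>I. char (\<mu> i) (t i))" for t
  proof -
    have "(\<Sum>i\<in>I. (t(j:=0)) i * X i \<omega>) = (\<Sum>i\<in>I. t i * X i \<omega>)" for \<omega>
      using insert.hyps by (intro sum.cong) auto
    moreover have "(\<Prod>i\<in>I. char (\<mu> i) ((t(j:=0)) i)) = (\<Prod>i\<in>I. char (\<mu> i) (t i))"
      using insert.hyps by (intro prod.cong) auto
    ultimately show ?thesis
      using insert.prems(4)[of "t(j := 0)"] insert.hyps real_distribution.char_zero[OF \<mu>j]
      by simp
  qed
  have split: "(CLINT \<omega>|M. indicator (B j) (X j \<omega>) *\<^sub>R iexp (\<Sum>i\<in>I. t i * X i \<omega>))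
      = measure (\<mu> j) (B j) * (\<Prod>i\<in>I. char (\<mu> i) (t i))" for t
  proof (subst char_split_imp_indep[where \<mu>="\<mu> j"])
    fix \<tau> r
    have "(\<Sum>i\<in>I. (\<lambda>i. if i = j then \<tau> else r * t i) i * X i \<omega>) = r * (\<Sum>i\<in>I. t i * X i \<omega>)" for \<omega>
      unfolding sum_distrib_left using insert.hyps by (intro sum.cong) auto
    moreover have "(\<Prod>i\<in>I. char (\<mu> i) ((\<lambda>i. if i = j then \<tau> else r * t i) i)) = (\<Prod>i\<in>I. char (\<mu> i) (r * t i))"
      using insert.hyps by (intro prod.cong) auto
    ultimately have "(CLINT \<omega>|M. iexp (\<tau> * X j \<omega> + r * (\<Sum>i\<in>I. t i * X i \<omega>))) = char (\<mu> j) \<tau> * (\<Prod>i\<in>I. char (\<mu> i) (r * t i))"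
      using insert.prems(4)[of "\<lambda>i. if i = j then \<tau> else r * t i"] insert.hyps by simp
    also have "(\<Prod>i\<in>I. char (\<mu> i) (r * t i)) = (CLINT \<omega>|M. iexp (r * (\<Sum>i\<in>I. t i * X i \<omega>)))"
      by (subst cfI[symmetric]) (simp add: sum_distrib_left mult.assoc)
    finally show "(CLINT \<omega>|M. iexp (\<tau> * X j \<omega> + r * (\<Sum>i\<in>I. t i * X i \<omega>))) =
        char (\<mu> j) \<tau> * (CLINT \<omega>|M. iexp (r * (\<Sum>i\<in>I. t i * X i \<omega>)))" .
  qed (use \<mu>j cfI in auto)
  define p where "p = measure (\<mu> j) (B j)"
  have "(CLINT \<omega>|M. complex_of_real (indicator (B j) (X j \<omega>))) = p"
    using split[of "\<lambda>_. 0"] by (simp add: p_def scaleR_conv_of_real real_distribution.char_zero insert.prems)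
  then have p: "(LINT \<omega>|M. indicator (B j) (X j \<omega>)) = p"
    by (metis integral_complex_of_real of_real_eq_iff)
  have intj: "integrable M (\<lambda>\<omega>. indicator (B j) (X j \<omega>) :: real)"
    by (auto intro!: integrable_const_bound[where B=1])
  have p0: "0 \<le> p" by (simp add: p_def)
  show ?case
  proof (cases "p = 0")
    case True
    \<comment> \<open>A null event cannot be conditioned on, but here both sides of the claim
      vanish.\<close>
    have "AE \<omega> in M. indicator (B j) (X j \<omega>) = (0::real)"
      using integral_nonneg_eq_0_iff_AE[OF intj] p True by auto
    then have "(LINT \<omega>|M. (\<Prod>i\<in>insert j I. indicator (B i) (X i \<omega>))) = (LINT \<omega>|M. (0::real))"
      using insert.hyps by (intro integral_cong_AE borel_measurable_prod) auto
    then show ?thesis using True insert.hyps by (simp add: p_def)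
  next
    case False
    then have "0 < p" using p0 by simp
    define N where "N = density M (\<lambda>\<omega>. ennreal (indicator (B j) (X j \<omega>) / p))"
    have N: "prob_space N"
    proof
      have "emeasure N (space N) = (\<integral>\<^sup>+\<omega>. ennreal (indicator (B j) (X j \<omega>) / p) \<partial>M)"
        unfolding N_def by (subst emeasure_density) (auto intro!: nn_integral_cong)
      also have "\<dots> = ennreal (LINT \<omega>|M. indicator (B j) (X j \<omega>) / p)"
        by (rule nn_integral_eq_integral) (use intj \<open>0 < p\<close> in auto)
      also have "(LINT \<omega>|M. indicator (B j) (X j \<omega>) / p) = 1"
        using \<open>0 < p\<close> p by simp
      finally show "emeasure N (space N) = 1" by simp
    qed
    have "(LINT \<omega>|N. (\<Prod>i\<in>I. indicator (B i) (X i \<omega>))) = (\<Prod>i\<in>I. measure (\<mu> i) (B i))"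
    proof (rule insert.IH[OF N])
      fix t
      have "(CLINT \<omega>|N. iexp (\<Sum>i\<in>I. t i * X i \<omega>)) =
         (CLINT \<omega>|M. (indicator (B j) (X j \<omega>) / p) *\<^sub>R iexp (\<Sum>i\<in>I. t i * X i \<omega>))"
        unfolding N_def by (subst integral_density) (use \<open>0 < p\<close> in auto)
      also have "\<dots> = (CLINT \<omega>|M. (indicator (B j) (X j \<omega>) *\<^sub>R iexp (\<Sum>i\<in>I. t i * X i \<omega>)) / p)"
        by (intro Bochner_Integration.integral_cong) (auto simp: scaleR_conv_of_real)
      also have "\<dots> = (CLINT \<omega>|M. (indicator (B j) (X j \<omega>) *\<^sub>R iexp (\<Sum>i\<in>I. t i * X i \<omega>))) / p"
        by (rule integral_divide_zero)
      also have "\<dots> = (\<Prod>i\<in>I. char (\<mu> i) (t i))"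
        unfolding split using \<open>0 < p\<close> by (simp add: p_def)
      finally show "(CLINT \<omega>|N. iexp (\<Sum>i\<in>I. t i * X i \<omega>)) = (\<Prod>i\<in>I. char (\<mu> i) (t i))" .
    qed (use insert.prems in \<open>auto simp: N_def\<close>)
    also have "(LINT \<omega>|N. (\<Prod>i\<in>I. indicator (B i) (X i \<omega>)) :: real) =
        (LINT \<omega>|M. (indicator (B j) (X j \<omega>) / p) * (\<Prod>i\<in>I. indicator (B i) (X i \<omega>)))"
      unfolding N_def by (subst integral_real_density) (use \<open>0 < p\<close> in auto)
    also have "\<dots> = (LINT \<omega>|M. (\<Prod>i\<in>insert j I. indicator (B i) (X i \<omega>))) / p"
      using insert.hyps by (subst integral_divide_zero[symmetric]) (auto intro!: Bochner_Integration.integral_cong)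
    finally show ?thesis
      using \<open>0 < p\<close> insert.hyps by (simp add: p_def field_simps)
  qed
qed

text \<open>Kac's theorem\<close>

lemma (in prob_space) indep_vars_if_char_prod:
  fixes X :: "'i \<Rightarrow> 'a \<Rightarrow> real"
  assumes I: "finite I" and X: "\<And>i. i \<in> I \<Longrightarrow> X i \<in> borel_measurable M"
    and cf: "\<And>t. (CLINT \<omega>|M. iexp (\<Sum>i\<in>I. t i * X i \<omega>)) = (\<Prod>i\<in>I. CLINT \<omega>|M. iexp (t i * X i \<omega>))"
  shows "indep_vars (\<lambda>_. borel) X I"
\<comment> \<open>The finite product criterion is for nonempty index sets: an empty intersection
  would be the whole type and not \<open>space M\<close>.\<close>
proof (cases "I = {}")
  case True
  then show ?thesis by (simp add: indep_vars_def2 indep_sets_def)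
next
  case False
  note X [measurable]
  show ?thesis
  proof (subst indep_vars_finite[where E="\<lambda>_. sets borel"])
    show "\<forall>A\<in>I \<rightarrow> sets borel. prob (\<Inter>j\<in>I. X j -` A j \<inter> space M) = (\<Prod>j\<in>I. prob (X j -` A j \<inter> space M))"
    proof
      fix A assume A: "A \<in> I \<rightarrow> sets (borel :: real measure)"
      have "char (distr M borel (X i)) (t i) = (CLINT \<omega>|M. iexp (t i * X i \<omega>))" if "i \<in> I" for i t
        unfolding char_def by (subst integral_distr) (use that in auto)
      then have "(LINT \<omega>|M. (\<Prod>i\<in>I. indicator (A i) (X i \<omega>))) = (\<Prod>i\<in>I. measure (distr M borel (X i)) (A i))"
        using A cf I by (intro char_prod_imp_prob_prod) (auto intro!: prob_space_axioms)
      also have "\<dots> = (\<Prod>i\<in>I. prob (X i -` A i \<inter> space M))"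
        by (intro prod.cong refl measure_distr) (use A in auto)
      also have "(LINT \<omega>|M. (\<Prod>i\<in>I. indicator (A i) (X i \<omega>))) =
          (LINT \<omega>|M. indicator (\<Inter>j\<in>I. X j -` A j \<inter> space M) \<omega> :: real)"
      proof (intro Bochner_Integration.integral_cong refl)
        fix \<omega> assume \<omega>: "\<omega> \<in> space M"
        show "(\<Prod>i\<in>I. indicator (A i) (X i \<omega>)) = (indicator (\<Inter>j\<in>I. X j -` A j \<inter> space M) \<omega> :: real)"
        proof (cases "\<forall>i\<in>I. X i \<omega> \<in> A i")
          case False
          then have "(\<Prod>i\<in>I. indicator (A i) (X i \<omega>)) = (0::real)"
            by (intro prod_zero[OF I]) (auto simp: indicator_def)
          with False show ?thesis by (auto simp: indicator_def)
        qed (use \<omega> in auto)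
      qed
      also have "\<dots> = prob (\<Inter>j\<in>I. X j -` A j \<inter> space M)"
        using False by (auto intro!: arg_cong[where f=prob])
      finally show "prob (\<Inter>j\<in>I. X j -` A j \<inter> space M) = (\<Prod>j\<in>I. prob (X j -` A j \<inter> space M))" .
    qed
  qed (use I False X in \<open>auto simp: Int_stable_def sets.sigma_sets_eq[of borel, simplified]\<close>)
qed

section \<open>Multiplicative cascades on the binary tree\<close>

text \<open>The fractions a / (a + b) and b / (a + b) lie in [0,1], where z <= z powr q; they add up
  to 1.\<close>

lemma powr_subadditive:
  fixes a b q :: real
  assumes "0 < a" "0 < b" "0 \<le> q" "q \<le> 1"
  shows "(a + b) powr q \<le> a powr q + b powr q"
proof -
  have *: "x / (a + b) * (a + b) powr q \<le> x powr q" if "0 < x" "x \<le> a + b" for x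
  proof -
    have "x / (a + b) = (x / (a + b)) powr 1"
      using that assms by simp
    also have "\<dots> \<le> (x / (a + b)) powr q"
      using that assms by (intro powr_mono') auto
    finally have "x / (a + b) * (a + b) powr q \<le> (x / (a + b)) powr q * (a + b) powr q"
      by (intro mult_right_mono) auto
    also have "\<dots> = x powr q"
      using that assms by (simp add: powr_divide)
    finally show ?thesis .
  qed
  have "(a + b) powr q = a / (a + b) * (a + b) powr q + b / (a + b) * (a + b) powr q"
    using assms by (simp add: distrib_right[symmetric] add_divide_distrib[symmetric])
  also have "\<dots> \<le> a powr q + b powr q"
    using assms by (intro add_mono *) auto
  finally show ?thesis .
qed

text \<open>One factor a + b is split off and \<open>powr_subadditive\<close> is applied to the
  remaining power p - 1. The cross terms contain only the exponents 1 and p - 1, so for independent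
  variables of mean one their expectations stay bounded without any second moment.\<close>

lemma powr_add_le_cross:
  fixes a b p :: real
  assumes "0 < a" "0 < b" "1 \<le> p" "p \<le> 2"
  shows "(a + b) powr p \<le> a powr p + b powr p + a * b powr (p - 1) + a powr (p - 1) * b"
proof -
  have pow: "x powr p = x * x powr (p - 1)" if "0 < x" for x :: real
    using that by (simp add: powr_diff)
  have "(a + b) powr p \<le> (a + b) * (a powr (p - 1) + b powr (p - 1))"
    using assms by (subst pow) (auto intro!: mult_left_mono powr_subadditive)
  also have "\<dots> = a powr p + b powr p + a * b powr (p - 1) + a powr (p - 1) * b"
    using assms by (simp add: pow algebra_simps)
  finally show ?thesis .
qed

lemma powr_le_1_add:
  fixes x q :: real
  assumes "0 < x" "0 \<le> q" "q \<le> 1"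
  shows "x powr q \<le> 1 + x"
proof (cases "x \<le> 1")
  case True
  then have "x powr q \<le> 1" using assms by (intro powr_le1) auto
  then show ?thesis using assms by simp
next
  case False
  then have "x powr q \<le> x powr 1" using assms by (intro powr_mono) auto
  then show ?thesis using assms by simp
qed

lemma (in prob_space) has_bochner_integral_indep_mult:
  fixes f g :: "real \<Rightarrow> real"
  assumes "indep_var borel X borel Y"
    and "f \<in> borel_measurable borel" "g \<in> borel_measurable borel"
    and "has_bochner_integral M (\<lambda>\<omega>. f (X \<omega>)) a" "has_bochner_integral M (\<lambda>\<omega>. g (Y \<omega>)) b"
  shows "has_bochner_integral M (\<lambda>\<omega>. f (X \<omega>) * g (Y \<omega>)) (a * b)"
proof -
  have ind: "indep_var borel (f \<circ> X) borel (g \<circ> Y)"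
    using assms by (intro indep_var_compose)
  then show ?thesis
    using indep_var_integrable[OF ind] indep_var_lebesgue_integral[OF ind] assms
    by (simp add: has_bochner_integral_iff comp_def)
qed

text \<open>A Paley-Zygmund argument with a moment of order p in place of the second. The mean 1 is
  at most 1/2 from Y < 1/2, plus m times the probability from 1/2 <= Y <= m, plus a tail beyond m
  that the p-th moment controls.\<close>

lemma (in prob_space) prob_ge_half_lower_bound:
  fixes Y :: "'a \<Rightarrow> real"
  assumes pos: "\<And>\<omega>. 0 < Y \<omega>" and EY: "has_bochner_integral M Y 1"
    and p: "1 < p" and int: "integrable M (\<lambda>\<omega>. Y \<omega> powr p)"
    and L: "expectation (\<lambda>\<omega>. Y \<omega> powr p) \<le> L" "0 < L"
  shows "1 / (4 * (4 * L) powr (1 / (p - 1))) \<le> prob {\<omega> \<in> space M. 1 / 2 \<le> Y \<omega>}"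
proof -
  \<comment> \<open>Chosen so that \<open>m powr (1 - p) * L\<close> is 1/4, which leaves a quarter
    of the mean for the middle range.\<close>
  define m where "m = (4 * L) powr (1 / (p - 1))"
  have m: "0 < m" using L by (simp add: m_def)
  have mp: "m powr (1 - p) = 1 / (4 * L)"
  proof -
    have "m powr (1 - p) = (4 * L) powr (- 1)"
      unfolding m_def powr_powr using p by (intro arg_cong2[where f="(powr)"]) (auto simp: divide_simps)
    then show ?thesis using L by (simp add: powr_minus_divide)
  qed
  have [measurable]: "Y \<in> borel_measurable M" using EY by (auto simp: has_bochner_integral_iff)
  define E where "E = {\<omega> \<in> space M. 1 / 2 \<le> Y \<omega>}"
  have [measurable]: "E \<in> events" by (simp add: E_def)
  have pt: "Y \<omega> \<le> 1 / 2 + m * indicator E \<omega> + m powr (1 - p) * Y \<omega> powr p" if "\<omega> \<in> space M" for \<omega>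
  proof (cases "Y \<omega> \<le> m \<or> Y \<omega> < 1 / 2")
    case True
    have nonneg: "0 \<le> m powr (1 - p) * Y \<omega> powr p" by simp
    show ?thesis
    proof (cases "1 / 2 \<le> Y \<omega>")
      case ge: True
      then have "Y \<omega> \<le> m" using True by simp
      moreover have "m * indicator E \<omega> = m" using ge that by (simp add: E_def)
      ultimately show ?thesis using nonneg by linarith
    next
      case False
      moreover have "m * indicator E \<omega> = 0" using False by (simp add: E_def)
      ultimately show ?thesis using nonneg by linarith
    qed
  next
    case False
    have "Y \<omega> = Y \<omega> powr (1 - p) * Y \<omega> powr p"
      using pos[of \<omega>] by (simp flip: powr_add)
    also have "\<dots> \<le> m powr (1 - p) * Y \<omega> powr p"
      using False m p by (intro mult_right_mono powr_mono2') auto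
    finally show ?thesis using m by (auto simp: indicator_def)
  qed
  have intE: "integrable M (\<lambda>\<omega>. indicator E \<omega> :: real)"
    by (auto intro!: integrable_const_bound[where B=1])
  have intR: "integrable M (\<lambda>\<omega>. 1 / 2 + m * indicator E \<omega> + m powr (1 - p) * Y \<omega> powr p)"
    by (intro Bochner_Integration.integrable_add integrable_mult_right intE int) auto
  have "1 = expectation Y" using EY by (simp add: has_bochner_integral_iff)
  also have "\<dots> \<le> expectation (\<lambda>\<omega>. 1 / 2 + m * indicator E \<omega> + m powr (1 - p) * Y \<omega> powr p)"
    using EY intR by (intro integral_mono pt) (auto simp: has_bochner_integral_iff)
  also have "\<dots> = 1 / 2 + m * prob E + m powr (1 - p) * expectation (\<lambda>\<omega>. Y \<omega> powr p)"
    using int intE by (simp add: prob_space)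
  also have "\<dots> \<le> 1 / 2 + m * prob E + 1 / 4"
    unfolding mp using L by (simp add: field_simps)
  finally have "1 / 4 \<le> m * prob E" by simp
  then have "1 / (4 * m) \<le> prob E" using m by (simp add: field_simps)
  then show ?thesis unfolding m_def E_def .
qed

text \<open>A deterministic function of a family of edge weights, \<open>x v\<close> being the
  weight of the edge into \<open>v\<close>. Separated from the random weights, two such sums are
  independent as soon as they read disjoint vertex sets.\<close>

primrec cascade_sum :: "nat \<Rightarrow> vertex \<Rightarrow> (vertex \<Rightarrow> real) \<Rightarrow> real" where
  "cascade_sum 0 u x = 1"
| "cascade_sum (Suc n) u x =
     (x (u @ [False]) * cascade_sum n (u @ [False]) x + x (u @ [True]) * cascade_sum n (u @ [True]) x) / 2"

text \<open>The vertices whose weights \<open>cascade_sum n u\<close> reads. The vertex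
  \<open>u\<close> is excluded, so the weight of the edge into \<open>u\<close> is independent of
  the sum below it.\<close>

definition descendants :: "vertex \<Rightarrow> nat \<Rightarrow> vertex set" where
  "descendants u n = {v. strict_prefix u v \<and> length v \<le> length u + n}"

lemma child_in_descendants: "u @ [b] \<in> descendants u (Suc n)"
  by (simp add: descendants_def strict_prefix_def)

lemma descendants_child_subset: "descendants (u @ [b]) n \<subseteq> descendants u (Suc n)"
  by (auto simp: descendants_def strict_prefix_def prefix_def)

lemma cascade_sum_cong:
  "(\<And>v. v \<in> descendants u n \<Longrightarrow> x v = y v) \<Longrightarrow> cascade_sum n u x = cascade_sum n u y"
proof (induction n arbitrary: u)
  case (Suc n)
  have "cascade_sum n (u @ [b]) x = cascade_sum n (u @ [b]) y" "x (u @ [b]) = y (u @ [b])" for b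
    using Suc.prems descendants_child_subset[of u b n] child_in_descendants[of u b n]
    by (auto intro!: Suc.IH)
  then show ?case by simp
qed simp

lemma measurable_cascade_sum:
  "descendants u n \<subseteq> K \<Longrightarrow> cascade_sum n u \<in> borel_measurable (PiM K (\<lambda>_. borel))"
proof (induction n arbitrary: u)
  case (Suc n)
  have "cascade_sum n (u @ [b]) \<in> borel_measurable (PiM K (\<lambda>_. borel))"
    "(\<lambda>x. x (u @ [b])) \<in> borel_measurable (PiM K (\<lambda>_. borel))" for b
    using Suc.prems descendants_child_subset[of u b n] child_in_descendants[of u b n]
    by (auto intro!: Suc.IH measurable_component_singleton)
  then have "(\<lambda>x. (x (u @ [False]) * cascade_sum n (u @ [False]) x + x (u @ [True]) * cascade_sum n (u @ [True]) x) / 2)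
      \<in> borel_measurable (PiM K (\<lambda>_. borel))"
    by (intro borel_measurable_divide borel_measurable_add borel_measurable_times) auto
  then show ?case by (simp add: cascade_sum.simps(2)[abs_def])
qed (simp add: cascade_sum.simps(1)[abs_def])

lemma cascade_sum_pos: "(\<And>v. 0 < x v) \<Longrightarrow> 0 < cascade_sum n u x"
  by (induction n arbitrary: u) (auto intro!: add_pos_pos mult_pos_pos)

text \<open>The moment formula is that of exp(G - v/2) for a centered Gaussian G of variance v,
  which depends on the depth only. It is required for all real t: t = 1 gives mean one, and t = p
  and t = -s give the other moments. Positivity at every outcome makes the laws of powers available
  pointwise.\<close>

locale multiplicative_cascade = prob_space M for M :: "'w measure" +
  fixes \<xi> :: "vertex \<Rightarrow> 'w \<Rightarrow> real" and N :: nat and v :: "nat \<Rightarrow> real"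
  assumes indep: "indep_vars (\<lambda>_. borel) \<xi> {u. u \<noteq> [] \<and> length u \<le> N}"
    and pos: "0 < \<xi> u \<omega>"
    and moment: "u \<noteq> [] \<Longrightarrow> length u \<le> N \<Longrightarrow>
      has_bochner_integral M (\<lambda>\<omega>. \<xi> u \<omega> powr t) (exp (t * (t - 1) * v (length u) / 2))"
begin

definition W :: "nat \<Rightarrow> vertex \<Rightarrow> 'w \<Rightarrow> real" where
  "W n u \<omega> = cascade_sum n u (\<lambda>v. \<xi> v \<omega>)"

definition Y :: "nat \<Rightarrow> vertex \<Rightarrow> 'w \<Rightarrow> real" where
  "Y n u \<omega> = \<xi> u \<omega> * W n u \<omega>"

section \<open>Independence and mean of the cascade\<close>

lemma W_0 [simp]: "W 0 u \<omega> = 1" by (simp add: W_def)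

lemma W_Suc: "W (Suc n) u \<omega> = (Y n (u @ [False]) \<omega> + Y n (u @ [True]) \<omega>) / 2"
  by (simp add: W_def Y_def)

lemma W_pos: "0 < W n u \<omega>"
  unfolding W_def by (rule cascade_sum_pos) (rule pos)

lemma Y_pos: "0 < Y n u \<omega>"
  unfolding Y_def by (intro mult_pos_pos pos W_pos)

lemma indep_xi_W:
  assumes "u \<noteq> []" "length u + n \<le> N"
  shows "indep_var borel (\<xi> u) borel (W n u)"
proof -
  have "indep_var borel ((\<lambda>x. x u) \<circ> (\<lambda>\<omega>. restrict (\<lambda>i. \<xi> i \<omega>) {u}))
     borel (cascade_sum n u \<circ> (\<lambda>\<omega>. restrict (\<lambda>i. \<xi> i \<omega>) (descendants u n)))"
    by (rule indep_var_compose[OF indep_var_restrict[OF indep]])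
      (use assms in \<open>auto simp: descendants_def measurable_cascade_sum\<close>)
  moreover have "cascade_sum n u \<circ> (\<lambda>\<omega>. restrict (\<lambda>i. \<xi> i \<omega>) (descendants u n)) = W n u"
    by (auto simp: W_def fun_eq_iff intro!: cascade_sum_cong)
  ultimately show ?thesis by (simp add: comp_def)
qed

text \<open>The two variables read disjoint sets of weights: the subtrees of the two children, each
  with the edge into its root.\<close>

lemma indep_Y:
  assumes "length u + Suc n \<le> N"
  shows "indep_var borel (Y n (u @ [False])) borel (Y n (u @ [True]))"
proof -
  define K where "K b = insert (u @ [b]) (descendants (u @ [b]) n)" for b
  define f where "f b x = x (u @ [b]) * cascade_sum n (u @ [b]) x" for b and x :: "vertex \<Rightarrow> real"
  have meas: "f b \<in> borel_measurable (PiM (K b) (\<lambda>_. borel))" for b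
    unfolding f_def K_def
    by (intro borel_measurable_times measurable_cascade_sum measurable_component_singleton) auto
  have "indep_var borel (f False \<circ> (\<lambda>\<omega>. restrict (\<lambda>i. \<xi> i \<omega>) (K False)))
     borel (f True \<circ> (\<lambda>\<omega>. restrict (\<lambda>i. \<xi> i \<omega>) (K True)))"
  proof (rule indep_var_compose[OF indep_var_restrict[OF indep]])
    show "K False \<inter> K True = {}"
      by (auto simp: K_def descendants_def strict_prefix_def prefix_def)
  qed (use assms meas in \<open>auto simp: K_def descendants_def\<close>)
  moreover have "f b \<circ> (\<lambda>\<omega>. restrict (\<lambda>i. \<xi> i \<omega>) (K b)) = Y n (u @ [b])" for b
    by (auto simp: W_def Y_def f_def K_def fun_eq_iff intro!: cascade_sum_cong)
  ultimately show ?thesis by simp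
qed

lemma measurable_W [measurable]:
  assumes "length u + n \<le> N"
  shows "W n u \<in> borel_measurable M"
proof (cases n)
  case (Suc m)
  have "(\<lambda>\<omega>. (Y m (u @ [False]) \<omega> + Y m (u @ [True]) \<omega>) / 2) \<in> borel_measurable M"
    using indep_Y[of u m] assms Suc
    by (intro borel_measurable_divide borel_measurable_add) (auto dest: indep_var_rv1 indep_var_rv2)
  then show ?thesis by (simp add: Suc W_Suc[abs_def])
qed (simp add: W_def[abs_def])

lemma measurable_Y [measurable]:
  assumes "u \<noteq> []" "length u + n \<le> N"
  shows "Y n u \<in> borel_measurable M"
  using indep_xi_W[OF assms] unfolding Y_def[abs_def]
  by (intro borel_measurable_times) (auto dest: indep_var_rv1 indep_var_rv2)

lemma has_bochner_integral_Y_powr: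
  assumes u: "u \<noteq> []" "length u + n \<le> N" and W: "integrable M (\<lambda>\<omega>. W n u \<omega> powr t)"
  shows "has_bochner_integral M (\<lambda>\<omega>. Y n u \<omega> powr t)
    (exp (t * (t - 1) * v (length u) / 2) * expectation (\<lambda>\<omega>. W n u \<omega> powr t))"
proof -
  have "Y n u \<omega> powr t = \<xi> u \<omega> powr t * W n u \<omega> powr t" for \<omega>
    unfolding Y_def using pos[of u \<omega>] W_pos[of n u \<omega>] by (simp add: powr_mult)
  then show ?thesis
    using has_bochner_integral_indep_mult[OF indep_xi_W[OF u],
        where f="\<lambda>x. x powr t" and g="\<lambda>x. x powr t"] moment[OF u(1)] u W
    by (simp add: has_bochner_integral_iff)
qed

lemma has_bochner_integral_W: "length u + n \<le> N \<Longrightarrow> has_bochner_integral M (W n u) 1"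
  and has_bochner_integral_Y: "u \<noteq> [] \<Longrightarrow> length u + n \<le> N \<Longrightarrow> has_bochner_integral M (Y n u) 1"
proof -
  have Y: "has_bochner_integral M (Y n u) 1"
    if "u \<noteq> []" "length u + n \<le> N" "has_bochner_integral M (W n u) 1" for n u
    using has_bochner_integral_Y_powr[OF that(1,2), of 1] that(3)
    by (simp add: W_pos Y_pos less_imp_le has_bochner_integral_iff)
  show *: "length u + n \<le> N \<Longrightarrow> has_bochner_integral M (W n u) 1" for n u
  proof (induction n arbitrary: u)
    case 0
    then show ?case by (simp add: W_def has_bochner_integral_iff prob_space)
  next
    case (Suc n)
    have "has_bochner_integral M (Y n (u @ [b])) 1" for b
      using Suc by (intro Y) auto
    then show ?case
      unfolding W_Suc by (simp add: has_bochner_integral_iff)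
  qed
  show "u \<noteq> [] \<Longrightarrow> length u + n \<le> N \<Longrightarrow> has_bochner_integral M (Y n u) 1"
    using Y * by simp
qed

text \<open>By \<open>powr_add_le_cross\<close> and independence, a generation multiplies the bound
  by 2 powr (1 - p) times exp(p (p - 1) v / 2) and adds at most 2 for the cross terms; unrolling
  this recursion gives the sum over \<open>j\<close>. The partial sums of \<open>v\<close> are kept
  because in deep levels only sums that start near the root will be controlled.\<close>

lemma W_powr_moment:
  assumes p: "1 < p" "p \<le> 2"
  shows "length u + n \<le> N \<Longrightarrow> integrable M (\<lambda>\<omega>. W n u \<omega> powr p) \<and>
    expectation (\<lambda>\<omega>. W n u \<omega> powr p) \<le>
      2 * (\<Sum>j\<le>n. exp (p * (p - 1) / 2 * (\<Sum>i<j. v (Suc (length u + i)))) * 2 powr (- (p - 1) * j))"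
proof (induction n arbitrary: u)
  case 0
  then show ?case by (simp add: prob_space)
next
  case (Suc n)
  define S where "S = (\<Sum>j\<le>n. exp (p * (p - 1) / 2 * (\<Sum>i<j. v (Suc (Suc (length u) + i)))) * 2 powr (- (p - 1) * j))"
  define e where "e = exp (p * (p - 1) / 2 * v (Suc (length u)))"
  let ?Y = "\<lambda>b. Y n (u @ [b])"
  have len: "length (u @ [b]) + n \<le> N" for b using Suc.prems by simp
  have W: "integrable M (\<lambda>\<omega>. W n (u @ [b]) \<omega> powr p)"
     "expectation (\<lambda>\<omega>. W n (u @ [b]) \<omega> powr p) \<le> 2 * S" for b
    using Suc.IH[OF len[of b]] by (simp_all add: S_def)
  have Yi: "integrable M (\<lambda>\<omega>. ?Y b \<omega> powr p)"
    and Ye: "expectation (\<lambda>\<omega>. ?Y b \<omega> powr p) \<le> e * (2 * S)" for b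
    using has_bochner_integral_Y_powr[OF _ len[of b] W(1)] W(2)[of b]
    by (auto simp: has_bochner_integral_iff e_def mult_ac)
  have Y1: "has_bochner_integral M (?Y b) 1" for b
    using len by (intro has_bochner_integral_Y) auto
  \<comment> \<open>Independence reduces each cross term to the moment of order p - 1 of one child,
    the other having mean one. As p - 1 <= 1, that moment is at most E(1 + Y) = 2.\<close>
  have Yq: "integrable M (\<lambda>\<omega>. ?Y b \<omega> powr (p - 1))" 
    and Yqe: "expectation (\<lambda>\<omega>. ?Y b \<omega> powr (p - 1)) \<le> 2" for b
  proof -
    have le: "?Y b \<omega> powr (p - 1) \<le> 1 + ?Y b \<omega>" for \<omega>
      using p by (intro powr_le_1_add Y_pos) auto
    have int: "integrable M (\<lambda>\<omega>. 1 + ?Y b \<omega>)" using Y1 by (auto simp: has_bochner_integral_iff)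
    show i: "integrable M (\<lambda>\<omega>. ?Y b \<omega> powr (p - 1))"
      using len[of b] by (rule_tac Bochner_Integration.integrable_bound[OF int])
        (auto intro!: AE_I2 order_trans[OF le])
    have "expectation (\<lambda>\<omega>. ?Y b \<omega> powr (p - 1)) \<le> expectation (\<lambda>\<omega>. 1 + ?Y b \<omega>)"
      by (intro integral_mono i int le)
    then show "expectation (\<lambda>\<omega>. ?Y b \<omega> powr (p - 1)) \<le> 2"
      using Y1[of b] by (simp add: has_bochner_integral_iff prob_space)
  qed
  have c1: "has_bochner_integral M (\<lambda>\<omega>. ?Y False \<omega> * ?Y True \<omega> powr (p - 1)) (1 * expectation (\<lambda>\<omega>. ?Y True \<omega> powr (p - 1)))"
    using Suc.prems Y1 Yq by (intro has_bochner_integral_indep_mult[OF indep_Y]) (auto simp: has_bochner_integral_iff)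
  have c2: "has_bochner_integral M (\<lambda>\<omega>. ?Y False \<omega> powr (p - 1) * ?Y True \<omega>) (expectation (\<lambda>\<omega>. ?Y False \<omega> powr (p - 1)) * 1)"
    using Suc.prems Y1 Yq by (intro has_bochner_integral_indep_mult[OF indep_Y]) (auto simp: has_bochner_integral_iff)
  let ?R = "\<lambda>\<omega>. 2 powr (- p) * (?Y False \<omega> powr p + ?Y True \<omega> powr p + ?Y False \<omega> * ?Y True \<omega> powr (p - 1) + ?Y False \<omega> powr (p - 1) * ?Y True \<omega>)"
  have le: "W (Suc n) u \<omega> powr p \<le> ?R \<omega>" for \<omega>
  proof -
    have "W (Suc n) u \<omega> powr p = 2 powr (- p) * (?Y False \<omega> + ?Y True \<omega>) powr p"
      unfolding W_Suc using Y_pos by (subst powr_divide) (auto simp: powr_minus field_simps less_imp_le add_nonneg_nonneg)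
    also have "\<dots> \<le> ?R \<omega>"
      using p by (intro mult_left_mono powr_add_le_cross Y_pos) auto
    finally show ?thesis .
  qed
  have intR: "integrable M ?R"
    using c1 c2 Yi by (auto simp: has_bochner_integral_iff)
  have int: "integrable M (\<lambda>\<omega>. W (Suc n) u \<omega> powr p)"
    using Suc.prems by (rule_tac Bochner_Integration.integrable_bound[OF intR])
        (auto intro!: AE_I2 order_trans[OF le])
  have "expectation (\<lambda>\<omega>. W (Suc n) u \<omega> powr p) \<le> expectation ?R"
    by (intro integral_mono int intR le)
  also have "expectation ?R = 2 powr (- p) * (expectation (\<lambda>\<omega>. ?Y False \<omega> powr p) + expectation (\<lambda>\<omega>. ?Y True \<omega> powr p)
       + expectation (\<lambda>\<omega>. ?Y True \<omega> powr (p - 1)) + expectation (\<lambda>\<omega>. ?Y False \<omega> powr (p - 1)))"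
    using c1 c2 Yi by (simp add: has_bochner_integral_iff)
  also have "\<dots> \<le> 2 powr (- p) * (e * (2 * S) + e * (2 * S) + 2 + 2)"
    using Ye Yqe by (intro mult_left_mono add_mono) auto
  also have "\<dots> = 2 * (2 powr (1 - p) * (e * S)) + 4 * 2 powr (- p)"
    by (simp add: powr_diff powr_minus field_simps)
  also have "2 powr (- p) \<le> 2 powr (- 1 :: real)"
    using p by (intro powr_mono) auto
  then have "4 * 2 powr (- p) \<le> 2" by (simp add: powr_minus)
  \<comment> \<open>The new generation becomes the first entry of every partial sum and shifts the
    index by one; the constant 2 just obtained is the term j = 0.\<close>
  also have "2 powr (1 - p) * (e * S) =
      (\<Sum>j\<le>n. exp (p * (p - 1) / 2 * (\<Sum>i<Suc j. v (Suc (length u + i)))) * 2 powr (- (p - 1) * Suc j))"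
  proof -
    have "2 powr (1 - p) * (e * (exp (p * (p - 1) / 2 * (\<Sum>i<j. v (Suc (Suc (length u) + i)))) * 2 powr (- (p - 1) * j)))
        = exp (p * (p - 1) / 2 * (\<Sum>i<Suc j. v (Suc (length u + i)))) * 2 powr (- (p - 1) * Suc j)" for j
      unfolding sum.lessThan_Suc_shift e_def
      by (simp add: algebra_simps exp_add[symmetric] powr_add[symmetric] del: sum.lessThan_Suc)
    then show ?thesis unfolding S_def sum_distrib_left by simp
  qed
  finally have "expectation (\<lambda>\<omega>. W (Suc n) u \<omega> powr p) \<le>
     2 * (1 + (\<Sum>j\<le>n. exp (p * (p - 1) / 2 * (\<Sum>i<Suc j. v (Suc (length u + i)))) * 2 powr (- (p - 1) * Suc j)))"
    by simp
  then show ?case using int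
    by (subst sum.atMost_Suc_shift) simp
qed

section \<open>Negative moments of the cascade\<close>

lemma W_Suc_ge: "Y n (u @ [b]) \<omega> / 2 \<le> W (Suc n) u \<omega>"
  using Y_pos[of n "u @ [False]" \<omega>] Y_pos[of n "u @ [True]" \<omega>]
  by (cases b) (simp_all add: W_Suc)

lemma W_Suc_powr_le:
  assumes "0 < s"
  shows "W (Suc n) u \<omega> powr (- s) \<le> 2 powr s * Y n (u @ [b]) \<omega> powr (- s)"
proof -
  have "W (Suc n) u \<omega> powr (- s) \<le> (Y n (u @ [b]) \<omega> / 2) powr (- s)"
    using assms Y_pos[of n "u @ [b]" \<omega>] W_Suc_ge[of n u b \<omega>] by (intro powr_mono2') auto
  also have "\<dots> = 2 powr s * Y n (u @ [b]) \<omega> powr (- s)"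
    using Y_pos[of n "u @ [b]" \<omega>] by (subst powr_divide) (auto simp: powr_minus field_simps)
  finally show ?thesis .
qed

text \<open>Dropping one of the two positive summands in each generation follows a single path down
  the tree, at the price of 2 powr s and one weight moment of order -s per level. This also yields
  the integrability of all negative powers.\<close>

lemma W_neg_moment_crude:
  assumes s: "0 < s"
  shows "length u + n \<le> N \<Longrightarrow> integrable M (\<lambda>\<omega>. W n u \<omega> powr (- s)) \<and>
    expectation (\<lambda>\<omega>. W n u \<omega> powr (- s)) \<le>
      2 powr (s * n) * exp (s * (s + 1) / 2 * (\<Sum>i<n. v (Suc (length u + i))))"
proof (induction n arbitrary: u)
  case 0
  then show ?case by (simp add: prob_space)
next
  case (Suc n)
  let ?u = "u @ [False]"
  have len: "length ?u + n \<le> N" using Suc.prems by simp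
  note IH = Suc.IH[OF len]
  have Y: "has_bochner_integral M (\<lambda>\<omega>. Y n ?u \<omega> powr (- s))
    (exp (s * (s + 1) / 2 * v (Suc (length u))) * expectation (\<lambda>\<omega>. W n ?u \<omega> powr (- s)))"
    using has_bochner_integral_Y_powr[OF _ len, of "- s"] IH by (simp add: algebra_simps)
  then have intR: "integrable M (\<lambda>\<omega>. 2 powr s * Y n ?u \<omega> powr (- s))"
    by (auto simp: has_bochner_integral_iff)
  have int: "integrable M (\<lambda>\<omega>. W (Suc n) u \<omega> powr (- s))"
    using Suc.prems s by (rule_tac Bochner_Integration.integrable_bound[OF intR])
        (auto intro!: AE_I2 order_trans[OF W_Suc_powr_le])
  have "expectation (\<lambda>\<omega>. W (Suc n) u \<omega> powr (- s)) \<le> expectation (\<lambda>\<omega>. 2 powr s * Y n ?u \<omega> powr (- s))"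
    by (intro integral_mono int intR W_Suc_powr_le s)
  also have "\<dots> = 2 powr s * (exp (s * (s + 1) / 2 * v (Suc (length u))) * expectation (\<lambda>\<omega>. W n ?u \<omega> powr (- s)))"
    using Y by (simp add: has_bochner_integral_iff)
  also have "\<dots> \<le> 2 powr s * (exp (s * (s + 1) / 2 * v (Suc (length u))) *
     (2 powr (s * n) * exp (s * (s + 1) / 2 * (\<Sum>i<n. v (Suc (length ?u + i))))))"
    using IH by (intro mult_left_mono) auto
  also have "\<dots> = 2 powr (s * Suc n) * exp (s * (s + 1) / 2 * (\<Sum>i<Suc n. v (Suc (length u + i))))"
    unfolding sum.lessThan_Suc_shift
    by (simp add: algebra_simps exp_add[symmetric] powr_add[symmetric] del: sum.lessThan_Suc)
  finally show ?case using int by simp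
qed

lemma integrable_W_neg: "0 < s \<Longrightarrow> length u + n \<le> N \<Longrightarrow> integrable M (\<lambda>\<omega>. W n u \<omega> powr (- s))"
  using W_neg_moment_crude by blast

lemma has_bochner_integral_Y_neg:
  assumes "0 < s" "u \<noteq> []" "length u + n \<le> N"
  shows "has_bochner_integral M (\<lambda>\<omega>. Y n u \<omega> powr (- s))
    (exp (s * (s + 1) / 2 * v (length u)) * expectation (\<lambda>\<omega>. W n u \<omega> powr (- s)))"
  using has_bochner_integral_Y_powr[OF assms(2,3) integrable_W_neg[OF assms(1,3)]]
  by (simp add: algebra_simps)

text \<open>If the first child satisfies Y >= 1/2 then W >= 1/4; otherwise W is at least half the Y
  of the second child. The event depends on the first child and the bound on the second, so
  independence extracts the factor 1 - c.\<close>

lemma W_neg_moment_contract: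
  assumes s: "0 < s" and len: "length u + Suc n \<le> N"
    and c: "c \<le> prob {\<omega> \<in> space M. 1 / 2 \<le> Y n (u @ [False]) \<omega>}"
  shows "expectation (\<lambda>\<omega>. W (Suc n) u \<omega> powr (- s)) \<le>
    4 powr s + 2 powr s * (1 - c) * exp (s * (s + 1) / 2 * v (Suc (length u))) *
      expectation (\<lambda>\<omega>. W n (u @ [True]) \<omega> powr (- s))"
proof -
  let ?Y = "\<lambda>b. Y n (u @ [b])"
  have [measurable]: "?Y b \<in> borel_measurable M" for b using len by (intro measurable_Y) auto
  have Y: "has_bochner_integral M (\<lambda>\<omega>. ?Y True \<omega> powr (- s))
    (exp (s * (s + 1) / 2 * v (Suc (length u))) * expectation (\<lambda>\<omega>. W n (u @ [True]) \<omega> powr (- s)))"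
    using has_bochner_integral_Y_neg[OF s, of "u @ [True]" n] len by simp
  have "(\<lambda>\<omega>. indicator {..<1/2} (?Y False \<omega>) :: real) \<in> borel_measurable M" by measurable
  then have I: "has_bochner_integral M (\<lambda>\<omega>. indicator {..<1/2} (?Y False \<omega>) :: real) 
      (1 - prob {\<omega> \<in> space M. 1 / 2 \<le> ?Y False \<omega>})"
  proof -
    have "has_bochner_integral M (indicator {\<omega> \<in> space M. \<not> 1 / 2 \<le> ?Y False \<omega>} :: _ \<Rightarrow> real)
        (prob {\<omega> \<in> space M. \<not> 1 / 2 \<le> ?Y False \<omega>})"
      by (rule has_bochner_integral_real_indicator) (auto simp: emeasure_eq_measure)
    also have "prob {\<omega> \<in> space M. \<not> 1 / 2 \<le> ?Y False \<omega>} = 1 - prob {\<omega> \<in> space M. 1 / 2 \<le> ?Y False \<omega>}"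
      by (rule prob_neg) auto
    finally show ?thesis
      by (rule has_bochner_integral_cong[THEN iffD1, rotated -1]) (auto simp: indicator_def)
  qed
  have prod: "has_bochner_integral M (\<lambda>\<omega>. indicator {..<1/2} (?Y False \<omega>) * ?Y True \<omega> powr (- s))
     ((1 - prob {\<omega> \<in> space M. 1 / 2 \<le> ?Y False \<omega>}) * 
       (exp (s * (s + 1) / 2 * v (Suc (length u))) * expectation (\<lambda>\<omega>. W n (u @ [True]) \<omega> powr (- s))))"
    by (rule has_bochner_integral_indep_mult[OF indep_Y[OF len] _ _ I Y]) auto
  let ?R = "\<lambda>\<omega>. 4 powr s + 2 powr s * (indicator {..<1/2} (?Y False \<omega>) * ?Y True \<omega> powr (- s))"
  have le: "W (Suc n) u \<omega> powr (- s) \<le> ?R \<omega>" for \<omega>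
  proof (cases "1 / 2 \<le> ?Y False \<omega>")
    case True
    have "W (Suc n) u \<omega> powr (- s) \<le> 2 powr s * ?Y False \<omega> powr (- s)" by (rule W_Suc_powr_le[OF s])
    also have "\<dots> \<le> 2 powr s * (1 / 2) powr (- s)"
      using True s by (intro mult_left_mono powr_mono2') auto
    also have "\<dots> = 4 powr s"
      by (simp add: powr_minus powr_divide flip: powr_mult)
    finally show ?thesis by (simp add: add_increasing2)
  next
    case False
    then show ?thesis using W_Suc_powr_le[OF s, of n u \<omega> True] by (simp add: add_increasing)
  qed
  have intR: "integrable M ?R" using prod by (auto simp: has_bochner_integral_iff)
  have "expectation (\<lambda>\<omega>. W (Suc n) u \<omega> powr (- s)) \<le> expectation ?R"
    using len by (intro integral_mono intR integrable_W_neg le s) auto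
  also have "\<dots> = 4 powr s + 2 powr s * ((1 - prob {\<omega> \<in> space M. 1 / 2 \<le> ?Y False \<omega>}) * 
       (exp (s * (s + 1) / 2 * v (Suc (length u))) * expectation (\<lambda>\<omega>. W n (u @ [True]) \<omega> powr (- s))))"
    using prod by (simp add: has_bochner_integral_iff prob_space)
  also have "\<dots> \<le> 4 powr s + 2 powr s * ((1 - c) * 
       (exp (s * (s + 1) / 2 * v (Suc (length u))) * expectation (\<lambda>\<omega>. W n (u @ [True]) \<omega> powr (- s))))"
    using c by (intro add_left_mono mult_left_mono mult_right_mono mult_nonneg_nonneg integral_nonneg) auto
  finally show ?thesis by (simp add: mult.assoc)
qed

text \<open>The arithmetic-geometric mean inequality trades a doubling of the exponent for one more
  generation.\<close>

lemma W_neg_moment_double: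
  assumes s: "0 < s" and len: "length u + Suc n \<le> N"
  shows "expectation (\<lambda>\<omega>. W (Suc n) u \<omega> powr (- (2 * s))) \<le>
    exp (s * (s + 1) * v (Suc (length u))) *
      (expectation (\<lambda>\<omega>. W n (u @ [False]) \<omega> powr (- s)) * expectation (\<lambda>\<omega>. W n (u @ [True]) \<omega> powr (- s)))"
proof -
  let ?Y = "\<lambda>b. Y n (u @ [b])"
  have Y: "has_bochner_integral M (\<lambda>\<omega>. ?Y b \<omega> powr (- s))
    (exp (s * (s + 1) / 2 * v (Suc (length u))) * expectation (\<lambda>\<omega>. W n (u @ [b]) \<omega> powr (- s)))" for b
    using has_bochner_integral_Y_neg[OF s, of "u @ [b]" n] len by simp
  have prod: "has_bochner_integral M (\<lambda>\<omega>. ?Y False \<omega> powr (- s) * ?Y True \<omega> powr (- s))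
    ((exp (s * (s + 1) / 2 * v (Suc (length u))) * expectation (\<lambda>\<omega>. W n (u @ [False]) \<omega> powr (- s))) *
     (exp (s * (s + 1) / 2 * v (Suc (length u))) * expectation (\<lambda>\<omega>. W n (u @ [True]) \<omega> powr (- s))))"
    by (rule has_bochner_integral_indep_mult[OF indep_Y[OF len] _ _ Y Y]) auto
  have le: "W (Suc n) u \<omega> powr (- (2 * s)) \<le> ?Y False \<omega> powr (- s) * ?Y True \<omega> powr (- s)" for \<omega>
  proof -
    let ?a = "?Y False \<omega>" and ?b = "?Y True \<omega>"
    have ab: "0 < ?a" "0 < ?b" by (rule Y_pos)+
    have "0 \<le> (?a - ?b)\<^sup>2" by simp
    then have "?a * ?b \<le> (W (Suc n) u \<omega>)\<^sup>2"
      by (simp add: W_Suc power2_eq_square field_simps)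
    also have "\<dots> = W (Suc n) u \<omega> powr 2" using W_pos[of "Suc n" u \<omega>] by simp
    finally have "(W (Suc n) u \<omega> powr 2) powr (- s) \<le> (?a * ?b) powr (- s)"
      using ab s by (intro powr_mono2') auto
    then show ?thesis using ab by (simp add: powr_powr powr_mult)
  qed
  have "expectation (\<lambda>\<omega>. W (Suc n) u \<omega> powr (- (2 * s))) \<le> expectation (\<lambda>\<omega>. ?Y False \<omega> powr (- s) * ?Y True \<omega> powr (- s))"
    using len s prod by (intro integral_mono integrable_W_neg le) (auto simp: has_bochner_integral_iff)
  also have "\<dots> = exp (s * (s + 1) * v (Suc (length u))) *
      (expectation (\<lambda>\<omega>. W n (u @ [False]) \<omega> powr (- s)) * expectation (\<lambda>\<omega>. W n (u @ [True]) \<omega> powr (- s)))"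
    using prod by (simp add: has_bochner_integral_iff mult_ac flip: exp_add)
  finally show ?thesis .
qed

end

section \<open>Contraction of small negative moments\<close>

context multiplicative_cascade begin

text \<open>The number r = exp((p - 1)(p q / 2 - ln 2)) is the ratio by which the p-th moment
  contracts per level of variance q, and p q / 2 < ln 2 makes it less than 1. A geometric series
  then bounds the p-th moment of Y by 4 / (1 - r), uniformly in n, and
  \<open>prob_ge_half_lower_bound\<close> applies. The sums of \<open>v\<close> start with the edge
  into the child, whose weight belongs to Y.\<close>

lemma prob_Y_ge_half:
  assumes p: "1 < p" "p \<le> 2" "p * q / 2 < ln 2"
    and len: "length u + Suc n \<le> N"
    and sums: "\<And>j. j \<le> Suc n \<Longrightarrow> (\<Sum>i<j. v (Suc (length u + i))) \<le> q * j"
  shows "1 / (4 * (4 * (4 / (1 - exp ((p - 1) * (p * q / 2 - ln 2))))) powr (1 / (p - 1)))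
    \<le> prob {\<omega> \<in> space M. 1 / 2 \<le> Y n (u @ [b]) \<omega>}"
proof (rule prob_ge_half_lower_bound[OF Y_pos _ p(1)])
  define r where "r = exp ((p - 1) * (p * q / 2 - ln 2))"
  define k where "k = p * (p - 1) / 2"
  have r: "0 < r" "r < 1" using p by (auto simp: r_def mult_pos_neg)
  have k: "0 \<le> k" using p by (simp add: k_def)
  have len': "length (u @ [b]) + n \<le> N" using len by simp
  show "has_bochner_integral M (Y n (u @ [b])) 1"
    using len' by (intro has_bochner_integral_Y) auto
  note W = W_powr_moment[OF p(1,2) len']
  have Y: "has_bochner_integral M (\<lambda>\<omega>. Y n (u @ [b]) \<omega> powr p)
    (exp (k * v (Suc (length u))) * expectation (\<lambda>\<omega>. W n (u @ [b]) \<omega> powr p))"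
    using has_bochner_integral_Y_powr[OF _ len' W[THEN conjunct1]] by (simp add: k_def)
  then show "integrable M (\<lambda>\<omega>. Y n (u @ [b]) \<omega> powr p)" by (simp add: has_bochner_integral_iff)
  \<comment> \<open>The exponentials cover j + 1 levels but the power of 2 only j; completing them
    to \<open>r ^ Suc j\<close> costs 2 powr (p - 1) <= 2.\<close>
  have term_le: "exp (k * v (Suc (length u))) * (exp (k * (\<Sum>i<j. v (Suc (length (u @ [b]) + i)))) * 2 powr (- (p - 1) * j))
      \<le> 2 * r ^ Suc j" if "j \<le> n" for j
  proof -
    have "exp (k * v (Suc (length u))) * exp (k * (\<Sum>i<j. v (Suc (length (u @ [b]) + i))))
        = exp (k * (\<Sum>i<Suc j. v (Suc (length u + i))))"
      unfolding sum.lessThan_Suc_shift by (simp add: algebra_simps flip: exp_add)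
    also have "\<dots> \<le> exp (k * (q * Suc j))"
      using sums[of "Suc j"] that k by (simp add: mult_left_mono del: sum.lessThan_Suc)
    finally have "exp (k * v (Suc (length u))) * exp (k * (\<Sum>i<j. v (Suc (length (u @ [b]) + i)))) * 2 powr (- (p - 1) * j)
       \<le> exp (k * (q * Suc j)) * 2 powr (- (p - 1) * j)"
      by (intro mult_right_mono) auto
    also have "\<dots> = 2 powr (p - 1) * (exp (k * (q * Suc j)) * 2 powr (- (p - 1) * Suc j))"
      by (simp add: algebra_simps flip: powr_add)
    also have "exp (k * (q * Suc j)) * 2 powr (- (p - 1) * Suc j) = r ^ Suc j"
    proof -
      have "r ^ Suc j = exp (real (Suc j) * ((p - 1) * (p * q / 2 - ln 2)))"
        unfolding r_def by (rule exp_of_nat_mult[symmetric])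
      also have "\<dots> = exp (k * (q * Suc j) + (- (p - 1) * Suc j) * ln 2)"
        by (rule arg_cong[where f=exp]) (simp add: k_def field_simps)
      also have "\<dots> = exp (k * (q * Suc j)) * 2 powr (- (p - 1) * Suc j)"
        by (simp add: exp_add powr_def)
      finally show ?thesis by simp
    qed
    also have "2 powr (p - 1) * r ^ Suc j \<le> 2 powr 1 * r ^ Suc j"
      using p r by (intro mult_right_mono powr_mono) auto
    finally show ?thesis by (simp add: mult.assoc)
  qed
  have "expectation (\<lambda>\<omega>. Y n (u @ [b]) \<omega> powr p) = exp (k * v (Suc (length u))) * expectation (\<lambda>\<omega>. W n (u @ [b]) \<omega> powr p)"
    using Y by (simp add: has_bochner_integral_iff)
  also have "\<dots> \<le> exp (k * v (Suc (length u))) *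
     (2 * (\<Sum>j\<le>n. exp (k * (\<Sum>i<j. v (Suc (length (u @ [b]) + i)))) * 2 powr (- (p - 1) * j)))"
    unfolding k_def using W[THEN conjunct2] by (intro mult_left_mono) auto
  also have "\<dots> = 2 * (\<Sum>j\<le>n. exp (k * v (Suc (length u))) * (exp (k * (\<Sum>i<j. v (Suc (length (u @ [b]) + i)))) * 2 powr (- (p - 1) * j)))"
    by (simp only: sum_distrib_left mult_ac)
  also have "\<dots> \<le> 2 * (\<Sum>j\<le>n. 2 * r ^ Suc j)"
    by (intro mult_left_mono sum_mono term_le) auto
  also have "\<dots> = 4 * r * (\<Sum>j<Suc n. r ^ j)"
    by (simp add: sum_distrib_left mult_ac lessThan_Suc_atMost del: sum.lessThan_Suc)
  also have "\<dots> \<le> 4 * 1 * (1 / (1 - r))"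
  proof (intro mult_mono)
    show "(\<Sum>j<Suc n. r ^ j) \<le> 1 / (1 - r)"
      using r by (subst sum_gp_strict) (auto intro!: divide_right_mono)
  qed (use r in \<open>auto intro!: sum_nonneg simp del: sum.lessThan_Suc\<close>)
  finally show "expectation (\<lambda>\<omega>. Y n (u @ [b]) \<omega> powr p) \<le> 4 / (1 - exp ((p - 1) * (p * q / 2 - ln 2)))"
    by (simp add: r_def)
  show "0 < 4 / (1 - exp ((p - 1) * (p * q / 2 - ln 2)))" using r by (simp add: r_def)
qed

text \<open>The induction is on \<open>m\<close>, the number of generations contracted while the
  depth is at most \<open>d\<close>; after them the crude bound takes over. The constant 4 powr s /
  (1 - \<rho>) is the fixed point of the map x to 4 powr s + \<rho> x.\<close>

lemma W_neg_moment_iterate: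
  fixes s \<rho> c d q B :: real
  assumes s: "0 < s" "s \<le> 1" and \<rho>: "0 \<le> \<rho>" "\<rho> < 1"
    and c: "\<And>u n. real (length u) \<le> d \<Longrightarrow> length u + Suc n \<le> N \<Longrightarrow>
      c \<le> prob {\<omega> \<in> space M. 1 / 2 \<le> Y n (u @ [False]) \<omega>}" "c \<le> 1"
    and q: "\<And>k. real k \<le> d \<Longrightarrow> Suc k \<le> N \<Longrightarrow> v (Suc k) \<le> q"
    and contr: "2 powr s * (1 - c) * exp (s * (s + 1) / 2 * q) \<le> \<rho>"
    and B: "\<And>k n. k + n \<le> N \<Longrightarrow> (\<Sum>i<n. v (Suc (k + i))) \<le> B * N" "0 \<le> B"
  shows "real (length u) + real m \<le> d \<Longrightarrow> m \<le> n \<Longrightarrow> length u + n \<le> N \<Longrightarrow>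
    expectation (\<lambda>\<omega>. W n u \<omega> powr (- s)) \<le> 4 powr s / (1 - \<rho>) + \<rho> ^ m * exp (s * (ln 2 + B) * N)"
proof (induction m arbitrary: u n)
  case 0
  have n: "real n \<le> real N" using 0 by simp
  have "s * (s + 1) / 2 * (\<Sum>i<n. v (Suc (length u + i))) \<le> s * (s + 1) / 2 * (B * N)"
    using B(1)[of "length u" n] 0 s by (intro mult_left_mono) auto
  \<comment> \<open>For s <= 1 the exponent s (s + 1) / 2 is at most s, so the crude bound is
    exponential with a rate linear in s.\<close>
  also have "\<dots> \<le> s * (B * N)"
    using s B(2) by (intro mult_right_mono) (auto simp: field_simps)
  finally have le: "exp (s * (s + 1) / 2 * (\<Sum>i<n. v (Suc (length u + i)))) \<le> exp (s * (B * N))" by simp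
  have "expectation (\<lambda>\<omega>. W n u \<omega> powr (- s)) \<le> 2 powr (s * n) * exp (s * (s + 1) / 2 * (\<Sum>i<n. v (Suc (length u + i))))"
    using W_neg_moment_crude[OF s(1) 0(3)] by blast
  also have "\<dots> \<le> 2 powr (s * N) * exp (s * (B * N))"
    using le n s by (intro mult_mono powr_mono mult_left_mono) auto
  also have "\<dots> = exp (s * (ln 2 + B) * N)"
    by (simp add: powr_def algebra_simps flip: exp_add)
  also have "\<dots> \<le> 4 powr s / (1 - \<rho>) + \<rho> ^ 0 * exp (s * (ln 2 + B) * N)"
    using \<rho> by simp
  finally show ?case .
next
  case (Suc m)
  then obtain n' where n: "n = Suc n'" by (cases n) auto
  let ?E = "expectation (\<lambda>\<omega>. W n' (u @ [True]) \<omega> powr (- s))"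
  have IH: "?E \<le> 4 powr s / (1 - \<rho>) + \<rho> ^ m * exp (s * (ln 2 + B) * N)"
    using Suc.prems n by (intro Suc.IH) auto
  have E: "0 \<le> ?E" by (intro Bochner_Integration.integral_nonneg) auto
  have ud: "real (length u) \<le> d" using Suc.prems by simp
  have "expectation (\<lambda>\<omega>. W n u \<omega> powr (- s)) \<le>
     4 powr s + 2 powr s * (1 - c) * exp (s * (s + 1) / 2 * v (Suc (length u))) * ?E"
    unfolding n by (rule W_neg_moment_contract[OF s(1) _ c(1)]) (use Suc.prems n ud in auto)
  also have "\<dots> \<le> 4 powr s + 2 powr s * (1 - c) * exp (s * (s + 1) / 2 * q) * ?E"
    using q[OF ud] c(2) E s Suc.prems n
    by (intro add_left_mono mult_right_mono mult_left_mono mult_nonneg_nonneg) (auto intro!: mult_left_mono)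
  also have "\<dots> \<le> 4 powr s + \<rho> * (4 powr s / (1 - \<rho>) + \<rho> ^ m * exp (s * (ln 2 + B) * N))"
    using contr IH E \<rho> by (intro add_left_mono mult_mono) auto
  also have "\<dots> = 4 powr s / (1 - \<rho>) + \<rho> ^ Suc m * exp (s * (ln 2 + B) * N)"
    using \<rho> by (simp add: field_simps)
  finally show ?case .
qed

end

section \<open>Uniform negative moments of subcritical cascades\<close>

text \<open>In the first condition only the start \<open>k\<close> is confined to the top
  \<open>\<delta> * N\<close> levels; the block may reach the bottom of the tree, as the p-th moment
  of a whole subtree requires. The second condition feeds the crude bound. For the CREM,
  \<open>q\<close> will lie strictly below 2 ln 2 and \<open>B\<close> will be \<beta>^2.\<close>

definition subcritical_variances :: "real \<Rightarrow> real \<Rightarrow> real \<Rightarrow> nat \<Rightarrow> (nat \<Rightarrow> real) \<Rightarrow> bool" where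
  "subcritical_variances q B \<delta> N v \<longleftrightarrow>
     (\<forall>k j. real k \<le> \<delta> * N \<longrightarrow> k + j \<le> N \<longrightarrow> (\<Sum>i<j. v (Suc (k + i))) \<le> q * j) \<and>
     (\<forall>k j. k + j \<le> N \<longrightarrow> (\<Sum>i<j. v (Suc (k + i))) \<le> B * N)"

text \<open>Constant and threshold may depend on the depth \<open>k\<close>, but not on the
  probability space, the weights or \<open>u\<close>. All depths are included because doubling the
  exponent at depth k uses the bound at depth k + 1. The argument of type \<open>'w itself\<close>
  fixes the type of the sample spaces quantified over.\<close>

definition bounded_neg_moments :: "'w itself \<Rightarrow> real \<Rightarrow> real \<Rightarrow> real \<Rightarrow> real \<Rightarrow> bool" where
  "bounded_neg_moments TYPE('w) q B \<delta> s \<longleftrightarrow>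
    (\<forall>k. \<exists>C N0. \<forall>N\<ge>N0. \<forall>(M :: 'w measure) \<xi> v u. multiplicative_cascade M \<xi> N v \<longrightarrow>
       subcritical_variances q B \<delta> N v \<longrightarrow> length u = k \<longrightarrow> k \<le> N \<longrightarrow>
       (LINT \<omega>|M. multiplicative_cascade.W \<xi> (N - k) u \<omega> powr (- s)) \<le> C)"

lemma bounded_neg_momentsE:
  assumes "bounded_neg_moments TYPE('w) q B \<delta> s"
  obtains C N0 where "\<And>N (M :: 'w measure) \<xi> v u. N0 \<le> N \<Longrightarrow> multiplicative_cascade M \<xi> N v \<Longrightarrow>
       subcritical_variances q B \<delta> N v \<Longrightarrow> length u = k \<Longrightarrow> k \<le> N \<Longrightarrow>
       (LINT \<omega>|M. multiplicative_cascade.W \<xi> (N - k) u \<omega> powr (- s)) \<le> C"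
proof -
  have "\<exists>C N0. \<forall>N\<ge>N0. \<forall>(M :: 'w measure) \<xi> v u. multiplicative_cascade M \<xi> N v \<longrightarrow>
       subcritical_variances q B \<delta> N v \<longrightarrow> length u = k \<longrightarrow> k \<le> N \<longrightarrow>
       (LINT \<omega>|M. multiplicative_cascade.W \<xi> (N - k) u \<omega> powr (- s)) \<le> C"
    using assms unfolding bounded_neg_moments_def by (rule spec)
  then show thesis
  proof (elim exE)
    fix C N0 assume "\<forall>N\<ge>N0. \<forall>(M :: 'w measure) \<xi> v u. multiplicative_cascade M \<xi> N v \<longrightarrow>
       subcritical_variances q B \<delta> N v \<longrightarrow> length u = k \<longrightarrow> k \<le> N \<longrightarrow>
       (LINT \<omega>|M. multiplicative_cascade.W \<xi> (N - k) u \<omega> powr (- s)) \<le> C"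
    then show thesis by (intro that[of N0 C]) blast
  qed
qed

lemma bounded_neg_moments_mono:
  assumes "bounded_neg_moments TYPE('w) q B \<delta> s" "0 < s'" "s' \<le> s"
  shows "bounded_neg_moments TYPE('w) q B \<delta> s'"
  unfolding bounded_neg_moments_def
proof
  fix k :: nat
  obtain C N0 where C: "\<And>N (M :: 'w measure) \<xi> v u. N0 \<le> N \<Longrightarrow> multiplicative_cascade M \<xi> N v \<Longrightarrow>
       subcritical_variances q B \<delta> N v \<Longrightarrow> length u = k \<Longrightarrow> k \<le> N \<Longrightarrow>
       (LINT \<omega>|M. multiplicative_cascade.W \<xi> (N - k) u \<omega> powr (- s)) \<le> C"
    by (rule bounded_neg_momentsE[OF assms(1), where k=k]) (erule that)
  show "\<exists>C N0. \<forall>N\<ge>N0. \<forall>(M :: 'w measure) \<xi> v u. multiplicative_cascade M \<xi> N v \<longrightarrow>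
       subcritical_variances q B \<delta> N v \<longrightarrow> length u = k \<longrightarrow> k \<le> N \<longrightarrow>
       (LINT \<omega>|M. multiplicative_cascade.W \<xi> (N - k) u \<omega> powr (- s')) \<le> C"
  proof (intro exI[of _ "1 + C"] exI[of _ N0] allI impI)
    fix N and M :: "'w measure" and \<xi> v and u :: vertex
    assume *: "N0 \<le> N" "multiplicative_cascade M \<xi> N v" "subcritical_variances q B \<delta> N v" "length u = k" "k \<le> N"
    interpret multiplicative_cascade M \<xi> N v by fact
    have le: "W (N - k) u \<omega> powr (- s') \<le> 1 + W (N - k) u \<omega> powr (- s)" for \<omega>
    proof (cases "1 \<le> W (N - k) u \<omega>")
      case True
      then have "W (N - k) u \<omega> powr (- s') \<le> W (N - k) u \<omega> powr 0"
        using assms by (intro powr_mono) auto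
      then show ?thesis using True by (simp add: add_increasing2)
    next
      case False
      then have "W (N - k) u \<omega> powr (- s') \<le> W (N - k) u \<omega> powr (- s)"
        using assms W_pos[of "N - k" u \<omega>] by (intro powr_mono') auto
      then show ?thesis by simp
    qed
    have "expectation (\<lambda>\<omega>. W (N - k) u \<omega> powr (- s')) \<le> expectation (\<lambda>\<omega>. 1 + W (N - k) u \<omega> powr (- s))"
      using * assms by (intro integral_mono le Bochner_Integration.integrable_add integrable_W_neg) auto
    also have "\<dots> = 1 + expectation (\<lambda>\<omega>. W (N - k) u \<omega> powr (- s))"
      using * assms integrable_W_neg[of s u "N - k"] by (simp add: prob_space)
    finally show "expectation (\<lambda>\<omega>. W (N - k) u \<omega> powr (- s')) \<le> 1 + C"
      using C[OF *] by simp
  qed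
qed

lemma bounded_neg_moments_double:
  assumes "bounded_neg_moments TYPE('w) q B \<delta> s" and s: "0 < s" and \<delta>: "0 < \<delta>"
  shows "bounded_neg_moments TYPE('w) q B \<delta> (2 * s)"
  unfolding bounded_neg_moments_def
proof
  fix k :: nat
  obtain C N0 where C: "\<And>N (M :: 'w measure) \<xi> v u. N0 \<le> N \<Longrightarrow> multiplicative_cascade M \<xi> N v \<Longrightarrow>
       subcritical_variances q B \<delta> N v \<Longrightarrow> length u = Suc k \<Longrightarrow> Suc k \<le> N \<Longrightarrow>
       (LINT \<omega>|M. multiplicative_cascade.W \<xi> (N - Suc k) u \<omega> powr (- s)) \<le> C"
    by (rule bounded_neg_momentsE[OF assms(1), where k="Suc k"]) (erule that)
  show "\<exists>C N0. \<forall>N\<ge>N0. \<forall>(M :: 'w measure) \<xi> v u. multiplicative_cascade M \<xi> N v \<longrightarrow>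
       subcritical_variances q B \<delta> N v \<longrightarrow> length u = k \<longrightarrow> k \<le> N \<longrightarrow>
       (LINT \<omega>|M. multiplicative_cascade.W \<xi> (N - k) u \<omega> powr (- (2 * s))) \<le> C"
  \<comment> \<open>The threshold guarantees that level k + 1 exists and that k <= \<delta> N, so
    that \<open>v (Suc k) \<le> q\<close> holds.\<close>
  proof (intro exI[of _ "exp (s * (s + 1) * q) * (C * C)"] exI[of _ "max N0 (max (Suc k) (nat \<lceil>k / \<delta>\<rceil>))"] allI impI)
    fix N and M :: "'w measure" and \<xi> v and u :: vertex
    assume *: "max N0 (max (Suc k) (nat \<lceil>k / \<delta>\<rceil>)) \<le> N" "multiplicative_cascade M \<xi> N v"
      "subcritical_variances q B \<delta> N v" "length u = k" "k \<le> N"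
    interpret multiplicative_cascade M \<xi> N v by fact
    have "k / \<delta> \<le> real N" using *(1) by linarith
    then have k\<delta>: "real k \<le> \<delta> * N" using \<delta> by (simp add: field_simps)
    have N: "N - k = Suc (N - Suc k)" "Suc k \<le> N" "N0 \<le> N" using *(1) by auto
    have v: "v (Suc k) \<le> q"
    proof -
      have "(\<Sum>i<1. v (Suc (k + i))) \<le> q * real 1"
        using *(3) k\<delta> N(2) unfolding subcritical_variances_def
        by (elim conjE allE[of _ k] allE[of _ 1]) simp
      then show ?thesis by simp
    qed
    let ?E = "\<lambda>b. expectation (\<lambda>\<omega>. W (N - Suc k) (u @ [b]) \<omega> powr (- s))"
    have E: "?E b \<le> C" "0 \<le> ?E b" for b
      using C[OF N(3) *(2,3), of "u @ [b]"] N *(4) by (auto intro!: Bochner_Integration.integral_nonneg)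
    have "expectation (\<lambda>\<omega>. W (N - k) u \<omega> powr (- (2 * s))) \<le> exp (s * (s + 1) * v (Suc k)) * (?E False * ?E True)"
      unfolding N(1) using W_neg_moment_double[OF s, of u "N - Suc k"] N *(4) by simp
    also have "\<dots> \<le> exp (s * (s + 1) * q) * (C * C)"
      using E v s order_trans[OF E(2,1)] by (intro mult_mono) (auto intro!: mult_left_mono)
    finally show "expectation (\<lambda>\<omega>. W (N - k) u \<omega> powr (- (2 * s))) \<le> exp (s * (s + 1) * q) * (C * C)" .
  qed
qed

text \<open>The order of choices matters: first p, then the probability bound c, which does not
  involve s, then \<rho> strictly between 1 - c and 1, and s last. As s tends to 0 the contraction
  factor tends to 1 - c and the rate s (ln 2 + B) of the crude bound tends to 0, so both
  requirements on s can be met.\<close>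

lemma bounded_neg_moments_small:
  assumes q: "0 < q" "q < 2 * ln 2" and B: "0 \<le> B" and \<delta>: "0 < \<delta>" "\<delta> \<le> 1"
  shows "\<exists>s>0. bounded_neg_moments TYPE('w) q B \<delta> s"
proof -
  obtain p where p: "1 < p" "p \<le> 2" "p * q / 2 < ln 2"
  proof -
    have "1 < min 2 (2 * ln 2 / q)" using q by (simp add: field_simps)
    then obtain p where "1 < p" "p < min 2 (2 * ln 2 / q)" using dense by blast
    then show ?thesis using q by (intro that[of p]) (auto simp: field_simps)
  qed
  define c where "c = min 1 (1 / (4 * (4 * (4 / (1 - exp ((p - 1) * (p * q / 2 - ln 2))))) powr (1 / (p - 1))))"
  have "exp ((p - 1) * (p * q / 2 - ln 2)) < 1" using p by (auto simp: mult_pos_neg)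
  then have c: "0 < c" "c \<le> 1" by (auto simp: c_def)
  define \<rho> where "\<rho> = 1 - c / 2"
  have \<rho>: "0 < \<rho>" "\<rho> < 1" "1 - c < \<rho>" using c by (auto simp: \<rho>_def)
  have "((\<lambda>s. 2 powr s * (1 - c) * exp (s * (s + 1) / 2 * q)) \<longlongrightarrow> 2 powr 0 * (1 - c) * exp (0 * (0 + 1) / 2 * q)) (at_right 0)"
    by (intro tendsto_intros) auto
  then have ev1: "\<forall>\<^sub>F s in at_right 0. 2 powr s * (1 - c) * exp (s * (s + 1) / 2 * q) < \<rho>"
    by (rule order_tendstoD) (use \<rho> in simp)
  have "((\<lambda>s. s * (ln 2 + B)) \<longlongrightarrow> 0 * (ln 2 + B)) (at_right 0)"
    by (intro tendsto_intros)
  \<comment> \<open>With this rate, \<delta> N / 2 contractions by \<rho> absorb the crude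
    bound.\<close>
  then have ev2: "\<forall>\<^sub>F s in at_right 0. s * (ln 2 + B) < \<delta> / 2 * (- ln \<rho>)"
    by (rule order_tendstoD) (use \<rho> \<delta> in \<open>simp add: mult_pos_neg\<close>)
  have ev3: "\<forall>\<^sub>F s in at_right (0::real). 0 < s \<and> s < 1"
    by (auto simp: eventually_at_right_field intro!: exI[of _ 1])
  have "\<exists>s. 2 powr s * (1 - c) * exp (s * (s + 1) / 2 * q) < \<rho> \<and> s * (ln 2 + B) < \<delta> / 2 * (- ln \<rho>) \<and> 0 < s \<and> s < 1"
    using eventually_conj[OF ev1 eventually_conj[OF ev2 ev3]] by (rule eventually_happens'[rotated]) simp
  then obtain s where s: "2 powr s * (1 - c) * exp (s * (s + 1) / 2 * q) < \<rho>"
    "s * (ln 2 + B) < \<delta> / 2 * (- ln \<rho>)" "0 < s" "s < 1" by blast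
  have "bounded_neg_moments TYPE('w) q B \<delta> s"
    unfolding bounded_neg_moments_def
  proof (intro allI exI[of _ "4 powr s / (1 - \<rho>) + 1"])
    fix k :: nat
    \<comment> \<open>Gives k + 1 <= \<delta> N / 2, so at least \<delta> N / 2 levels remain
      between depth k and the integer part of \<delta> N; the 1 pays for the rounding.\<close>
    define N0 where "N0 = nat \<lceil>2 * (k + 1) / \<delta>\<rceil>"
    show "\<exists>N0. \<forall>N\<ge>N0. \<forall>(M :: 'w measure) \<xi> v u. multiplicative_cascade M \<xi> N v \<longrightarrow>
       subcritical_variances q B \<delta> N v \<longrightarrow> length u = k \<longrightarrow> k \<le> N \<longrightarrow>
       (LINT \<omega>|M. multiplicative_cascade.W \<xi> (N - k) u \<omega> powr (- s)) \<le> 4 powr s / (1 - \<rho>) + 1"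
    proof (intro exI[of _ N0] allI impI)
      fix N and M :: "'w measure" and \<xi> v and u :: vertex
      assume *: "N0 \<le> N" "multiplicative_cascade M \<xi> N v" "subcritical_variances q B \<delta> N v" "length u = k" "k \<le> N"
      interpret multiplicative_cascade M \<xi> N v by fact
      define m where "m = nat \<lfloor>\<delta> * N\<rfloor> - k"
      have k: "real k + 1 \<le> \<delta> / 2 * N"
      proof -
        have "2 * (k + 1) / \<delta> \<le> real N" using *(1) unfolding N0_def by linarith
        then show ?thesis using \<delta>(1) by (simp add: field_simps)
      qed
      have \<delta>N: "\<delta> * N \<le> N" using \<delta> by (simp add: mult_left_le_one_le)
      have fl: "real (nat \<lfloor>\<delta> * N\<rfloor>) \<le> \<delta> * N" "\<delta> * N - 1 \<le> real (nat \<lfloor>\<delta> * N\<rfloor>)"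
        using \<delta> by (auto simp: of_nat_nat)
      have "real k \<le> real (nat \<lfloor>\<delta> * N\<rfloor>)" using k fl(2) by linarith
      then have "k \<le> nat \<lfloor>\<delta> * N\<rfloor>" by (simp only: of_nat_le_iff)
      then have m: "real k + real m = real (nat \<lfloor>\<delta> * N\<rfloor>)" by (simp add: m_def)
      have m1: "real k + real m \<le> \<delta> * N" using m fl(1) by linarith
      have m3: "\<delta> / 2 * N \<le> real m" using m fl(2) k by linarith
      have m2: "m \<le> N - k"
      proof -
        have "real k + real m \<le> real N" using m1 \<delta>N by linarith
        then show ?thesis by linarith
      qed
      have sums: "(\<Sum>i<j. v (Suc (l + i))) \<le> q * j" if "real l \<le> \<delta> * N" "l + j \<le> N" for l j
        using *(3) that unfolding subcritical_variances_def by blast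
      have "expectation (\<lambda>\<omega>. W (N - k) u \<omega> powr (- s)) \<le>
          4 powr s / (1 - \<rho>) + \<rho> ^ m * exp (s * (ln 2 + B) * N)"
      proof (rule W_neg_moment_iterate[where d="\<delta> * N" and c=c and q=q])
        fix u :: vertex and n
        assume u: "real (length u) \<le> \<delta> * N" "length u + Suc n \<le> N"
        have "1 / (4 * (4 * (4 / (1 - exp ((p - 1) * (p * q / 2 - ln 2))))) powr (1 / (p - 1)))
            \<le> prob {\<omega> \<in> space M. 1 / 2 \<le> Y n (u @ [False]) \<omega>}"
          by (rule prob_Y_ge_half[OF p u(2)]) (rule sums, use u in auto)
        then show "c \<le> prob {\<omega> \<in> space M. 1 / 2 \<le> Y n (u @ [False]) \<omega>}"
          unfolding c_def by (rule min.coboundedI2)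
      next
        fix l assume "real l \<le> \<delta> * N" "Suc l \<le> N"
        then show "v (Suc l) \<le> q" using sums[of l 1] by simp
      next
        fix l n assume "l + n \<le> N"
        then show "(\<Sum>i<n. v (Suc (l + i))) \<le> B * N"
          using *(3) unfolding subcritical_variances_def by blast
      qed (use s \<rho> c B m1 m2 * in auto)
      also have "\<rho> ^ m * exp (s * (ln 2 + B) * N) \<le> 1"
      proof -
        have "s * (ln 2 + B) * N \<le> \<delta> / 2 * (- ln \<rho>) * N"
          using s by (intro mult_right_mono) auto
        also have "\<dots> = (\<delta> / 2 * N) * (- ln \<rho>)" by simp
        also have "\<dots> \<le> real m * (- ln \<rho>)"
          using m3 \<rho> by (intro mult_right_mono) auto
        finally have "exp (s * (ln 2 + B) * N) \<le> exp (- (real m * ln \<rho>))" by simp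
        moreover have "\<rho> ^ m = exp (real m * ln \<rho>)"
          using \<rho> by (simp add: exp_of_nat_mult)
        ultimately have "\<rho> ^ m * exp (s * (ln 2 + B) * N) \<le> exp (real m * ln \<rho>) * exp (- (real m * ln \<rho>))"
          by simp
        then show ?thesis by (simp flip: exp_add)
      qed
      finally show "expectation (\<lambda>\<omega>. W (N - k) u \<omega> powr (- s)) \<le> 4 powr s / (1 - \<rho>) + 1"
        by simp
    qed
  qed
  then show ?thesis using s by blast
qed

lemma bounded_neg_moments_all:
  assumes q: "0 < q" "q < 2 * ln 2" and B: "0 \<le> B" and \<delta>: "0 < \<delta>" "\<delta> \<le> 1" and s: "0 < s"
  shows "bounded_neg_moments TYPE('w) q B \<delta> s"
proof -
  obtain s0 where s0: "0 < s0" "bounded_neg_moments TYPE('w) q B \<delta> s0"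
    using bounded_neg_moments_small[OF q B \<delta>] by blast
  have "bounded_neg_moments TYPE('w) q B \<delta> (2 ^ m * s0)" for m
  proof (induction m)
    case (Suc m)
    then show ?case using bounded_neg_moments_double[OF Suc _ \<delta>(1)] s0 by (simp add: mult.assoc)
  qed (use s0 in simp)
  moreover obtain m :: nat where "s / s0 < 2 ^ m" using real_arch_pow[of 2 "s / s0"] by auto
  moreover have "s \<le> 2 ^ m * s0" using calculation(2) s0(1) by (simp add: pos_divide_less_eq)
  ultimately show ?thesis
    using s by (blast intro: bounded_neg_moments_mono)
qed

section \<open>The covariance profile near the origin\<close>

text \<open>The concave hull vanishes at 0 and lies below its tangent there, so A y <= K y on the
  whole interval; hence K >= 1 and A'(0) <= K. Near 0 the Hoelder condition keeps A' below K' and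
  the mean value theorem bounds increments. For y farther away, A y - A x <= K y suffices once x is
  small.\<close>

lemma covariance_profile_increments:
  assumes A: "A \<in> {0..1} \<rightarrow> {0..1}" "covariance_profile A"
    and K': "right_deriv (concave_hull A) 0 < K'"
  shows covariance_profile_right_deriv_ge_1: "1 \<le> right_deriv (concave_hull A) 0"
    and covariance_profile_increments_le: "\<exists>\<delta>\<in>{0<..1}. \<forall>x y. 0 \<le> x \<longrightarrow> x \<le> \<delta> \<longrightarrow> x \<le> y \<longrightarrow> y \<le> 1 \<longrightarrow> A y - A x \<le> K' * (y - x)"
proof -
  define K where "K = right_deriv (concave_hull A) 0"
  have A01: "0 \<le> A x" "A x \<le> 1" if "x \<in> {0..1}" for x using A(1) that by auto
  have A0: "A 0 = 0" and A1: "A 1 = 1" and holder: "holder_deriv_near_0 A"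
    and hd: "concave_hull A differentiable (at_right 0)"
    using A(2) by (auto simp: covariance_profile_def)
  obtain \<alpha> x1 A' where *: "\<alpha> \<in> {0<..<1}" "x1 \<in> {0<..1}"
    "\<forall>x\<in>{0..x1}. (A has_real_derivative A' x) (at x within {0..1})"
    and bdd: "bdd_above {\<bar>A' x - A' y\<bar> / \<bar>x - y\<bar> powr \<alpha> | x y.
                     x \<in> {0..x1} \<and> y \<in> {0..x1} \<and> x \<noteq> y}"
    using holder unfolding holder_deriv_near_0_def by blast
  then have \<alpha>: "0 < \<alpha>" and x1: "0 < x1" "x1 \<le> 1"
    and A': "\<And>x. x \<in> {0..x1} \<Longrightarrow> (A has_real_derivative A' x) (at x within {0..1})"
    by auto
  have right: "at (0::real) within {0..1} = at_right 0"
    by (rule at_within_Icc_at_right) simp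
  have lim: "((\<lambda>x. A x / x) \<longlongrightarrow> A' 0) (at_right 0)"
    using A'[of 0] x1 by (simp add: has_field_derivative_iff right A0)
  then have "\<forall>\<^sub>F x in at_right 0. A x / x < \<bar>A' 0\<bar> + 1"
    by (rule order_tendstoD) simp
  then obtain e where e: "0 < e" and Ae: "\<And>x. 0 < x \<Longrightarrow> x < e \<Longrightarrow> A x / x < \<bar>A' 0\<bar> + 1"
    by (auto simp: eventually_at_right_field)
  \<comment> \<open>The slope of a linear majorant of A: the derivative at 0 handles y < e, and 1 /
    e handles y >= e because A <= 1. This majorant forces the concave hull to vanish at 0.\<close>
  define L where "L = \<bar>A' 0\<bar> + 1 + 1 / e"
  have AL: "A y \<le> L * y" if "y \<in> {0..1}" for y
  proof -
    have "y = 0 \<or> 0 < y" using that by auto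
    then consider "y = 0" | "0 < y" "y < e" | "e \<le> y" by fastforce
    then show ?thesis
    proof cases
      case 2
      then have "A y \<le> (\<bar>A' 0\<bar> + 1) * y" using Ae[of y] by (simp add: field_simps)
      also have "\<dots> \<le> L * y" using 2 e by (intro mult_right_mono) (auto simp: L_def)
      finally show ?thesis .
    next
      case 3
      have "A y \<le> 1" using A01 that by blast
      also have "1 \<le> 1 / e * y" using 3 e by (simp add: field_simps)
      also have "\<dots> \<le> L * y" using that by (intro mult_right_mono) (auto simp: L_def)
      finally show ?thesis .
    qed (simp add: A0)
  qed
  define h where "h = concave_hull A"
  have "concave_on {0..1} (\<lambda>x. L * x)"
    by (auto simp: concave_on_iff algebra_simps)
  then have "h 0 \<le> L * 0"
    unfolding h_def by (rule concave_hull_le) (use AL in auto)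
  moreover have "A 0 \<le> h 0"
    unfolding h_def by (rule concave_hull_majorant[where B=1]) (use A01 in auto)
  ultimately have h0: "h 0 = 0" using A0 by simp
  have "(h has_vector_derivative K) (at_right 0)"
    using hd unfolding h_def K_def right_deriv_def by (rule vector_derivative_works[THEN iffD1])
  then have limh: "((\<lambda>x. h x / x) \<longlongrightarrow> K) (at_right 0)"
    by (simp add: has_real_derivative_iff_has_vector_derivative[symmetric] has_field_derivative_iff h0)
  have conc: "concave_on {0..1} h"
    unfolding h_def by (rule concave_on_concave_hull[where B=1]) (use A01 in auto)
  have AK: "A y \<le> K * y" if y: "y \<in> {0..1}" for y
  proof (cases "y = 0")
    case False
    then have y0: "0 < y" using y by simp
    \<comment> \<open>Chords of a concave function from the origin have decreasing slopes; letting x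
      tend to 0 compares them with the right derivative K.\<close>
    have "h y / y \<le> h x / x" if "0 < x" "x < y" for x
    proof -
      have "(x / y) * h y + (1 - x / y) * h 0 \<le> h ((x / y) *\<^sub>R y + (1 - x / y) *\<^sub>R 0)"
        by (rule conc[unfolded concave_on_iff, THEN conjunct2, rule_format]) (use that y in auto)
      then show ?thesis using that y0 by (simp add: h0 field_simps)
    qed
    then have "\<forall>\<^sub>F x in at_right 0. h y / y \<le> h x / x"
      using y0 by (auto simp: eventually_at_right_field)
    then have "h y / y \<le> K"
      by (rule tendsto_lowerbound[OF limh]) (simp add: trivial_limit_at_right_real)
    moreover have "A y \<le> h y"
      unfolding h_def by (rule concave_hull_majorant[where B=1]) (use A01 y in auto)
    ultimately show ?thesis using y0 by (simp add: field_simps)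
  qed (simp add: A0)
  show "1 \<le> right_deriv (concave_hull A) 0"
    using AK[of 1] A1 by (simp add: K_def)
  then have K: "1 \<le> K" by (simp add: K_def)
  have "\<forall>\<^sub>F x in at_right 0. A x / x \<le> K"
    unfolding eventually_at_right_field using AK by (intro exI[of _ 1]) (auto simp: field_simps)
  then have A'0: "A' 0 \<le> K"
    by (rule tendsto_upperbound[OF lim]) (simp add: trivial_limit_at_right_real)
  obtain C where C: "\<And>x. x \<in> {0<..x1} \<Longrightarrow> \<bar>A' x - A' 0\<bar> / \<bar>x - 0\<bar> powr \<alpha> \<le> C"
  proof -
    obtain C where C: "\<forall>z \<in> {\<bar>A' x - A' y\<bar> / \<bar>x - y\<bar> powr \<alpha> | x y.
                     x \<in> {0..x1} \<and> y \<in> {0..x1} \<and> x \<noteq> y}. z \<le> C"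
      using bdd unfolding bdd_above_def by blast
    show ?thesis
    proof (rule that)
      fix x assume "x \<in> {0<..x1}"
      then have "x \<in> {0..x1}" "0 \<in> {0..x1}" "x \<noteq> 0" using x1 by auto
      then show "\<bar>A' x - A' 0\<bar> / \<bar>x - 0\<bar> powr \<alpha> \<le> C"
        by (intro C[THEN bspec]) blast
    qed
  qed
  define \<eta> where "\<eta> = K' - K"
  have \<eta>: "0 < \<eta>" using K' by (simp add: \<eta>_def K_def)
  \<comment> \<open>On (0, \<delta>1] the Hoelder bound C x powr \<alpha> on A' x - A' 0 is at most
    \<eta>. Using |C| + 1 keeps the denominator positive.\<close>
  define \<delta>1 where "\<delta>1 = min x1 ((\<eta> / (\<bar>C\<bar> + 1)) powr (1 / \<alpha>))"
  have \<delta>1: "0 < \<delta>1" "\<delta>1 \<le> x1" using x1 \<eta> by (auto simp: \<delta>1_def)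
  have A'K': "A' x \<le> K'" if "x \<in> {0<..\<delta>1}" for x
  proof -
    have "x powr \<alpha> \<le> ((\<eta> / (\<bar>C\<bar> + 1)) powr (1 / \<alpha>)) powr \<alpha>"
      using that \<alpha> by (intro powr_mono2) (auto simp: \<delta>1_def)
    also have "\<dots> = \<eta> / (\<bar>C\<bar> + 1)" using \<alpha> \<eta> by (simp add: powr_powr)
    finally have "(\<bar>C\<bar> + 1) * x powr \<alpha> \<le> \<eta>" by (simp add: field_simps)
    moreover have "\<bar>A' x - A' 0\<bar> \<le> C * x powr \<alpha>"
      using C[of x] that \<delta>1 by (simp add: field_simps)
    moreover have "C * x powr \<alpha> \<le> (\<bar>C\<bar> + 1) * x powr \<alpha>"
      by (intro mult_right_mono) auto
    ultimately show ?thesis using A'0 by (simp add: \<eta>_def)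
  qed
  have small: "A y - A x \<le> K' * (y - x)" if "0 \<le> x" "x \<le> y" "y \<le> \<delta>1" for x y
  proof (cases "x = y")
    case False
    then have "x < y" using that by simp
    have "\<exists>z\<in>{x<..<y}. A y - A x = A' z * (y - x)"
    proof (rule mvt_simple[OF \<open>x < y\<close>])
      fix z assume z: "x \<le> z" "z \<le> y"
      have "(A has_real_derivative A' z) (at z within {x..y})"
        by (rule DERIV_subset[OF A']) (use z that \<delta>1 x1 in auto)
      then show "(A has_derivative (*) (A' z)) (at z within {x..y})"
        by (simp add: has_field_derivative_def)
    qed
    then show ?thesis using A'K' that by (auto intro!: mult_right_mono)
  qed simp
  \<comment> \<open>The solution of K \<delta> = \<eta> (\<delta>1 - \<delta>): for x <= \<delta>
    and y > \<delta>1 the excess K x is then at most \<eta> (y - x).\<close>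
  define \<delta> where "\<delta> = \<delta>1 * \<eta> / K'"
  have K'pos: "0 < K'" using K \<eta> by (simp add: \<eta>_def)
  have \<delta>: "0 < \<delta>" "\<delta> \<le> \<delta>1"
    using \<delta>1 \<eta> K K'pos by (auto simp: \<delta>_def \<eta>_def field_simps)
  have \<delta>K: "K * \<delta> = \<eta> * (\<delta>1 - \<delta>)"
    using K'pos by (simp add: \<delta>_def \<eta>_def field_simps)
  show "\<exists>\<delta>\<in>{0<..1}. \<forall>x y. 0 \<le> x \<longrightarrow> x \<le> \<delta> \<longrightarrow> x \<le> y \<longrightarrow> y \<le> 1 \<longrightarrow> A y - A x \<le> K' * (y - x)"
  proof (intro bexI[of _ \<delta>] allI impI)
    fix x y assume xy: "0 \<le> x" "x \<le> \<delta>" "x \<le> y" "y \<le> 1"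
    show "A y - A x \<le> K' * (y - x)"
    proof (cases "y \<le> \<delta>1")
      case False
      have "A y - A x \<le> K * y" using AK[of y] A01[of x] xy by auto
      also have "\<dots> = K * (y - x) + K * x" by (simp add: algebra_simps)
      also have "K * x \<le> K * \<delta>" using K xy by simp
      also have "\<dots> \<le> \<eta> * (y - x)" unfolding \<delta>K using False xy \<eta> by (intro mult_left_mono) auto
      also have "K * (y - x) + \<eta> * (y - x) = K' * (y - x)" by (simp add: \<eta>_def algebra_simps)
      finally show ?thesis by simp
    qed (use small xy in auto)
  qed (use \<delta> \<delta>1 x1 in auto)
qed

section \<open>The continuous random energy model as a cascade\<close>

text \<open>Completing the square: the exponential tilt moves the mean of the Gaussian density to
  \<open>t * \<sigma>\<^sup>2\<close> and leaves a constant factor.\<close>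

lemma has_bochner_integral_exp_normal_density:
  assumes "0 < \<sigma>"
  shows "has_bochner_integral lborel (\<lambda>x. normal_density 0 \<sigma> x * exp (t * x)) (exp (t\<^sup>2 * \<sigma>\<^sup>2 / 2))"
proof -
  have "normal_density 0 \<sigma> x * exp (t * x) = exp (t\<^sup>2 * \<sigma>\<^sup>2 / 2) * normal_density (t * \<sigma>\<^sup>2) \<sigma> x" for x
  proof -
    have "- x\<^sup>2 / (2 * \<sigma>\<^sup>2) + t * x = t\<^sup>2 * \<sigma>\<^sup>2 / 2 + - (x - t * \<sigma>\<^sup>2)\<^sup>2 / (2 * \<sigma>\<^sup>2)"
      using assms by (simp add: field_simps power2_eq_square)
    then show ?thesis
      unfolding normal_density_def by (simp flip: exp_add)
  qed
  then show ?thesis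
    using assms by (simp add: has_bochner_integral_iff)
qed

section \<open>Exponential moments and characteristic functions of centered Gaussians\<close>

context prob_space begin

text \<open>The degenerate case does occur: an edge increment has variance zero wherever A takes
  equal values at consecutive levels.\<close>

lemma centered_gaussian_rv_cases:
  assumes "gaussian_rv M Y" "expectation Y = 0"
  obtains (normal) \<sigma> where "0 < \<sigma>" "distributed M lborel Y (\<lambda>x. ennreal (normal_density 0 \<sigma> x))"
      "expectation (\<lambda>\<omega>. (Y \<omega>)\<^sup>2) = \<sigma>\<^sup>2"
    | (degenerate) "AE \<omega> in M. Y \<omega> = 0" "expectation (\<lambda>\<omega>. (Y \<omega>)\<^sup>2) = 0"
proof -
  have [measurable]: "Y \<in> borel_measurable M" using assms by (simp add: gaussian_rv_def)
  consider (1) \<mu> \<sigma> where "0 < \<sigma>" "distributed M lborel Y (\<lambda>x. ennreal (normal_density \<mu> \<sigma> x))"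
    | (2) \<mu> where "AE \<omega> in M. Y \<omega> = \<mu>"
    using assms(1) unfolding gaussian_rv_def by auto
  then show ?thesis
  proof cases
    case 1
    then have "\<mu> = 0" using normal_distributed_expectation[OF 1] assms(2) by simp
    then show ?thesis
      using normal 1 normal_distributed_variance[OF 1] assms(2) by simp
  next
    case 2
    then have "expectation Y = expectation (\<lambda>_. \<mu>)" by (intro integral_cong_AE) auto
    then have "\<mu> = 0" using assms(2) by (simp add: prob_space)
    then have ae: "AE \<omega> in M. Y \<omega> = 0" using 2 by simp
    then have "expectation (\<lambda>\<omega>. (Y \<omega>)\<^sup>2) = expectation (\<lambda>_. 0)" by (intro integral_cong_AE) auto
    then show ?thesis using degenerate ae by simp
  qed
qed

lemma centered_gaussian_rv_mgf:
  assumes "gaussian_rv M Y" "expectation Y = 0"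
  shows "has_bochner_integral M (\<lambda>\<omega>. exp (t * Y \<omega>)) (exp (t\<^sup>2 * expectation (\<lambda>\<omega>. (Y \<omega>)\<^sup>2) / 2))"
  using assms
proof (cases rule: centered_gaussian_rv_cases)
  case (normal \<sigma>)
  then show ?thesis
    using has_bochner_integral_exp_normal_density[OF normal(1), of t]
      distributed_integrable[OF normal(2), of "\<lambda>x. exp (t * x)"]
      distributed_integral[OF normal(2), of "\<lambda>x. exp (t * x)"]
    by (simp add: has_bochner_integral_iff)
next
  case degenerate
  have [measurable]: "Y \<in> borel_measurable M" using assms by (simp add: gaussian_rv_def)
  have "has_bochner_integral M (\<lambda>\<omega>. exp (t * Y \<omega>)) 1 \<longleftrightarrow> has_bochner_integral M (\<lambda>\<omega>. 1::real) 1"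
    using degenerate(1) by (intro has_bochner_integral_cong_AE) auto
  then show ?thesis using degenerate(2) by (simp add: has_bochner_integral_iff prob_space)
qed

lemma centered_gaussian_rv_square_integrable:
  assumes "gaussian_rv M Y" "expectation Y = 0"
  shows "integrable M (\<lambda>\<omega>. (Y \<omega>)\<^sup>2)"
  using assms
proof (cases rule: centered_gaussian_rv_cases)
  case (normal \<sigma>)
  then show ?thesis
    using integrable_normal_moment[OF normal(1), of 0 2]
      distributed_integrable[OF normal(2), of "\<lambda>x. x\<^sup>2"] by simp
next
  case degenerate
  have [measurable]: "Y \<in> borel_measurable M" using assms by (simp add: gaussian_rv_def)
  have "integrable M (\<lambda>\<omega>. (Y \<omega>)\<^sup>2) \<longleftrightarrow> integrable M (\<lambda>\<omega>. 0::real)"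
    using degenerate(1) by (intro integrable_cong_AE) auto
  then show ?thesis by simp
qed

lemma centered_gaussian_rv_char:
  assumes "gaussian_rv M Y" "expectation Y = 0"
  shows "(CLINT \<omega>|M. iexp (Y \<omega>)) = complex_of_real (exp (- expectation (\<lambda>\<omega>. (Y \<omega>)\<^sup>2) / 2))"
  using assms
proof (cases rule: centered_gaussian_rv_cases)
  case (normal \<sigma>)
  have [measurable]: "Y \<in> borel_measurable M" using assms by (simp add: gaussian_rv_def)
  have "distributed M lborel (\<lambda>x. (Y x - 0) / \<sigma>) std_normal_density"
    using normal normal_standard_normal_convert[OF normal(1), of Y 0] by simp
  then have d: "distr M borel (\<lambda>x. Y x / \<sigma>) = std_normal_distribution"
    by (auto dest!: distributed_distr_eq_density cong: distr_cong)
  have "(CLINT \<omega>|M. iexp (Y \<omega>)) = (CLINT \<omega>|M. iexp (\<sigma> * (Y \<omega> / \<sigma>)))"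
    using normal(1) by simp
  also have "\<dots> = char (distr M borel (\<lambda>x. Y x / \<sigma>)) \<sigma>"
    unfolding char_def by (subst integral_distr) auto
  also have "\<dots> = complex_of_real (exp (- \<sigma>\<^sup>2 / 2))"
    unfolding d char_std_normal_distribution by simp
  finally show ?thesis using normal by simp
next
  case degenerate
  have [measurable]: "Y \<in> borel_measurable M" using assms by (simp add: gaussian_rv_def)
  have "(CLINT \<omega>|M. iexp (Y \<omega>)) = (CLINT \<omega>|M. 1)"
    using degenerate(1) by (intro integral_cong_AE) auto
  then show ?thesis using degenerate(2) by (simp add: prob_space)
qed

end

section \<open>Common ancestors in the binary tree\<close>

lemma longest_common_prefix_butlast:
  "\<not> prefix u w \<Longrightarrow> longest_common_prefix (butlast u) w = longest_common_prefix u w"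
  by (induction u w rule: longest_common_prefix.induct) auto

lemma longest_common_prefix_commute: "longest_common_prefix u w = longest_common_prefix w u"
  by (induction u w rule: longest_common_prefix.induct) (auto simp: longest_common_prefix.simps elim: longest_common_prefix.elims)

lemma longest_common_prefix_absorb: "prefix u w \<Longrightarrow> longest_common_prefix u w = u"
  by (induction u w rule: longest_common_prefix.induct) auto

text \<open>This makes the increments along distinct edges uncorrelated.\<close>

lemma mrca_mixed_difference:
  fixes g :: "nat \<Rightarrow> real"
  assumes "u \<noteq> w"
  shows "g (length (mrca u w)) - g (length (mrca (butlast u) w)) - g (length (mrca u (butlast w)))
    + g (length (mrca (butlast u) (butlast w))) = 0"
proof -
  \<comment> \<open>If u is not a prefix of w, removing its last letter changes its common prefix
    neither with w nor with \<open>butlast w\<close>, so the terms cancel in pairs. Of two distinct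
    vertices, at least one is not a prefix of the other.\<close>
  have *: "g (length (mrca u w)) - g (length (mrca (butlast u) w)) - g (length (mrca u (butlast w)))
    + g (length (mrca (butlast u) (butlast w))) = 0" if "\<not> prefix u w" for u w
  proof -
    have "\<not> prefix u (butlast w)"
      using that prefix_order.trans[OF _ prefixeq_butlast] by blast
    then show ?thesis using that by (simp add: longest_common_prefix_butlast)
  qed
  consider "\<not> prefix u w" | "\<not> prefix w u"
    using assms prefix_order.antisym by blast
  then show ?thesis
  proof cases
    case 2
    from *[OF this] show ?thesis
      by (simp add: longest_common_prefix_commute[of u] longest_common_prefix_commute[of "butlast u"] algebra_simps)
  qed (rule *)
qed

lemma finite_nonempty_lists_le: "finite {u :: bool list. u \<noteq> [] \<and> length u \<le> N}"
  by (rule finite_subset[OF _ finite_lists_length_le[of UNIV N]]) auto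

lemma sum_lists_length_Suc:
  "(\<Sum>w | length w = Suc n. f w) = (\<Sum>w | length w = n. f (False # w)) + (\<Sum>w | length w = n. f (True # w))"
  for f :: "bool list \<Rightarrow> real"
proof -
  have fin: "finite {w :: bool list. length w = n}"
    using finite_lists_length_eq[of "UNIV :: bool set" n] by simp
  have "{w :: bool list. length w = Suc n} = (#) False ` {w. length w = n} \<union> (#) True ` {w. length w = n}"
    by (auto simp: length_Suc_conv image_iff)
  also have "sum f \<dots> = sum f ((#) False ` {w. length w = n}) + sum f ((#) True ` {w. length w = n})"
    using fin by (intro sum.union_disjoint) auto
  also have "\<dots> = (\<Sum>w | length w = n. f (False # w)) + (\<Sum>w | length w = n. f (True # w))"
    by (subst (1 2) sum.reindex) (auto simp: inj_on_def comp_def)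
  finally show ?thesis .
qed

section \<open>Independent increments of the CREM\<close>

locale crem_process =
  fixes A :: "real \<Rightarrow> real" and N :: nat and M :: "'w measure" and X :: "vertex \<Rightarrow> 'w \<Rightarrow> real" and \<beta> :: real
  assumes crem: "crem A N M X" and N: "0 < N" and A0: "A 0 = 0" and A1: "A 1 = 1"
begin

sublocale prob_space M
  using crem by (simp add: crem_def centered_gaussian_process_def gaussian_process_def)

definition "inc u \<omega> = X u \<omega> - X (butlast u) \<omega>"
definition "level_var k = real N * A (real k / real N) - real N * A (real (k - 1) / real N)"
text \<open>On the edges of the tree, \<open>\<beta>\<^sup>2 * level_var (length u) / 2\<close> is
  the logarithm of the mean of \<open>exp (\<beta> * inc u \<omega>)\<close>, so the weights have
  mean one.\<close>

definition "\<xi> u \<omega> = exp (\<beta> * inc u \<omega> - \<beta>\<^sup>2 * level_var (length u) / 2)"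

abbreviation "I \<equiv> {u :: vertex. u \<noteq> [] \<and> length u \<le> N}"

lemma finite_tree: "finite (binary_tree N)"
  using finite_lists_length_le[of "UNIV :: bool set" N] by (simp add: binary_tree_def)

lemma gaussian_X: "u \<in> binary_tree N \<Longrightarrow> gaussian_rv M (X u)"
  and gaussian_sum: "gaussian_rv M (\<lambda>\<omega>. \<Sum>i\<in>binary_tree N. c i * X i \<omega>)"
  and EX: "u \<in> binary_tree N \<Longrightarrow> expectation (X u) = 0"
  and EXX: "u \<in> binary_tree N \<Longrightarrow> w \<in> binary_tree N \<Longrightarrow>
    expectation (\<lambda>\<omega>. X u \<omega> * X w \<omega>) = real N * A (real (length (mrca u w)) / real N)"
proof -
  have g: "\<And>J c. finite J \<Longrightarrow> J \<subseteq> binary_tree N \<Longrightarrow> gaussian_rv M (\<lambda>\<omega>. \<Sum>i\<in>J. c i * X i \<omega>)"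
    using crem by (auto simp: crem_def centered_gaussian_process_def gaussian_process_def)
  show "u \<in> binary_tree N \<Longrightarrow> gaussian_rv M (X u)" using g[of "{u}" "\<lambda>_. 1"] by simp
  show "gaussian_rv M (\<lambda>\<omega>. \<Sum>i\<in>binary_tree N. c i * X i \<omega>)" using g finite_tree by blast
qed (use crem in \<open>auto simp: crem_def centered_gaussian_process_def\<close>)

lemma measurable_X [measurable]: "u \<in> binary_tree N \<Longrightarrow> X u \<in> borel_measurable M"
  using gaussian_X by (simp add: gaussian_rv_def)

lemma integrable_XX: "u \<in> binary_tree N \<Longrightarrow> w \<in> binary_tree N \<Longrightarrow> integrable M (\<lambda>\<omega>. X u \<omega> * X w \<omega>)"
proof -
  assume u: "u \<in> binary_tree N" and w: "w \<in> binary_tree N"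
  have "integrable M (\<lambda>\<omega>. (X u \<omega>)\<^sup>2 + (X w \<omega>)\<^sup>2)"
    using u w by (intro Bochner_Integration.integrable_add centered_gaussian_rv_square_integrable gaussian_X EX)
  then show ?thesis
  proof (rule Bochner_Integration.integrable_bound)
    show "(\<lambda>\<omega>. X u \<omega> * X w \<omega>) \<in> borel_measurable M" using u w by simp
    have "\<bar>x * y\<bar> \<le> x\<^sup>2 + y\<^sup>2" for x y :: real
      using sum_squares_bound[of "\<bar>x\<bar>" "\<bar>y\<bar>", unfolded power2_abs] mult_nonneg_nonneg[OF abs_ge_zero[of x] abs_ge_zero[of y]]
      unfolding abs_mult by linarith
    then show "AE \<omega> in M. norm (X u \<omega> * X w \<omega>) \<le> norm ((X u \<omega>)\<^sup>2 + (X w \<omega>)\<^sup>2)" by simp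
  qed
qed

lemma integrable_X: "u \<in> binary_tree N \<Longrightarrow> integrable M (X u)"
  by (rule square_integrable_imp_integrable) (auto intro: centered_gaussian_rv_square_integrable gaussian_X EX)

lemma I_tree: "u \<in> I \<Longrightarrow> u \<in> binary_tree N" "u \<in> I \<Longrightarrow> butlast u \<in> binary_tree N"
  by (auto simp: binary_tree_def)

lemma cov_inc:
  assumes "u \<in> I" "w \<in> I"
  shows "has_bochner_integral M (\<lambda>\<omega>. inc u \<omega> * inc w \<omega>) (if u = w then level_var (length u) else 0)"
proof -
  define g where "g k = real N * A (real k / real N)" for k
  note [simp] = I_tree[OF assms(1)] I_tree[OF assms(2)]
  have eq: "inc u \<omega> * inc w \<omega> = X u \<omega> * X w \<omega> - X (butlast u) \<omega> * X w \<omega> - X u \<omega> * X (butlast w) \<omega> + X (butlast u) \<omega> * X (butlast w) \<omega>" for \<omega>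
    by (simp add: inc_def algebra_simps)
  have "has_bochner_integral M (\<lambda>\<omega>. inc u \<omega> * inc w \<omega>)
     (g (length (mrca u w)) - g (length (mrca (butlast u) w)) - g (length (mrca u (butlast w)))
       + g (length (mrca (butlast u) (butlast w))))"
    unfolding eq by (simp add: has_bochner_integral_iff integrable_XX EXX g_def)
  also have "g (length (mrca u w)) - g (length (mrca (butlast u) w)) - g (length (mrca u (butlast w)))
       + g (length (mrca (butlast u) (butlast w))) = (if u = w then level_var (length u) else 0)"
  proof (cases "u = w")
    case True
    have "mrca u u = u" "mrca (butlast u) u = butlast u" "mrca (butlast u) (butlast u) = butlast u"
      "mrca u (butlast u) = butlast u"
      by (simp_all add: longest_common_prefix_absorb prefixeq_butlast longest_common_prefix_commute[of u "butlast u"])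
    then show ?thesis using True by (simp add: level_var_def g_def)
  qed (simp add: mrca_mixed_difference)
  finally show ?thesis .
qed

text \<open>Combinations of increments are combinations of the \<open>X w\<close>, hence Gaussian,
  and by \<open>cov_inc\<close> their variance has no cross terms. As a centered Gaussian law is
  determined by its variance, this fixes the joint characteristic function of the
  increments.\<close>

lemma inc_combination:
  "gaussian_rv M (\<lambda>\<omega>. \<Sum>u\<in>I. c u * inc u \<omega>)"
  "expectation (\<lambda>\<omega>. \<Sum>u\<in>I. c u * inc u \<omega>) = 0"
  "expectation (\<lambda>\<omega>. (\<Sum>u\<in>I. c u * inc u \<omega>)\<^sup>2) = (\<Sum>u\<in>I. (c u)\<^sup>2 * level_var (length u))"
proof -
  \<comment> \<open>The coefficient of \<open>X w\<close> after expanding the increments: each edge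
    adds \<open>c u\<close> at its lower end and subtracts it at its upper end.\<close>
  define e where "e w = (\<Sum>u\<in>I. c u * (of_bool (w = u) - of_bool (w = butlast u)))" for w
  have "(\<Sum>u\<in>I. c u * inc u \<omega>) = (\<Sum>w\<in>binary_tree N. e w * X w \<omega>)" for \<omega>
  proof -
    have "inc u \<omega> = (\<Sum>w\<in>binary_tree N. (of_bool (w = u) - of_bool (w = butlast u)) * X w \<omega>)" if "u \<in> I" for u
      using I_tree[OF that] finite_tree
      by (simp add: inc_def left_diff_distrib sum_subtractf of_bool_def if_distrib[of "\<lambda>x. x * _"] cong: if_cong)
    then have "(\<Sum>u\<in>I. c u * inc u \<omega>) = (\<Sum>u\<in>I. \<Sum>w\<in>binary_tree N. c u * (of_bool (w = u) - of_bool (w = butlast u)) * X w \<omega>)"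
      by (simp add: sum_distrib_left mult.assoc)
    also have "\<dots> = (\<Sum>w\<in>binary_tree N. e w * X w \<omega>)"
      unfolding e_def sum_distrib_right by (rule sum.swap)
    finally show ?thesis .
  qed
  then show "gaussian_rv M (\<lambda>\<omega>. \<Sum>u\<in>I. c u * inc u \<omega>)"
    using gaussian_sum[of e] by simp
  have "integrable M (inc u)" "expectation (inc u) = 0" if "u \<in> I" for u
    using I_tree[OF that] by (simp_all add: inc_def[abs_def] integrable_X EX)
  then show "expectation (\<lambda>\<omega>. \<Sum>u\<in>I. c u * inc u \<omega>) = 0" by simp
  have "(\<Sum>u\<in>I. c u * inc u \<omega>)\<^sup>2 = (\<Sum>u\<in>I. \<Sum>w\<in>I. c u * c w * (inc u \<omega> * inc w \<omega>))" for \<omega>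
    by (simp add: power2_eq_square sum_product mult_ac)
  moreover have "has_bochner_integral M (\<lambda>\<omega>. \<Sum>u\<in>I. \<Sum>w\<in>I. c u * c w * (inc u \<omega> * inc w \<omega>))
      (\<Sum>u\<in>I. \<Sum>w\<in>I. c u * c w * (if u = w then level_var (length u) else 0))"
    by (intro has_bochner_integral_sum has_bochner_integral_mult_right cov_inc)
  ultimately have "expectation (\<lambda>\<omega>. (\<Sum>u\<in>I. c u * inc u \<omega>)\<^sup>2) =
      (\<Sum>u\<in>I. \<Sum>w\<in>I. c u * c w * (if u = w then level_var (length u) else 0))"
    by (simp add: has_bochner_integral_iff)
  also have "\<dots> = (\<Sum>u\<in>I. (c u)\<^sup>2 * level_var (length u))"
    using finite_nonempty_lists_le[of N]
    by (intro sum.cong refl) (simp add: power2_eq_square if_distrib[of "\<lambda>x. _ * x"] cong: if_cong)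
  finally show "expectation (\<lambda>\<omega>. (\<Sum>u\<in>I. c u * inc u \<omega>)\<^sup>2) = (\<Sum>u\<in>I. (c u)\<^sup>2 * level_var (length u))" .
qed

lemma inc_gaussian:
  assumes "u \<in> I"
  shows "gaussian_rv M (inc u)" "expectation (inc u) = 0" "expectation (\<lambda>\<omega>. (inc u \<omega>)\<^sup>2) = level_var (length u)"
proof -
  have "(\<Sum>w\<in>I. of_bool (w = u) * inc w \<omega>) = inc u \<omega>" for \<omega>
    using assms finite_nonempty_lists_le[of N]
    by (simp add: of_bool_def if_distrib[of "\<lambda>x. x * _"] cong: if_cong)
  then show "gaussian_rv M (inc u)" "expectation (inc u) = 0"
    using inc_combination(1,2)[of "\<lambda>w. of_bool (w = u)"] by simp_all
  show "expectation (\<lambda>\<omega>. (inc u \<omega>)\<^sup>2) = level_var (length u)"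
    using cov_inc[OF assms assms] by (simp add: has_bochner_integral_iff power2_eq_square)
qed

text \<open>The joint characteristic function is the exponential of a diagonal quadratic form, hence
  a product, and \<open>indep_vars_if_char_prod\<close> applies.\<close>

lemma indep_inc: "indep_vars (\<lambda>_. borel) inc I"
proof (rule indep_vars_if_char_prod[OF finite_nonempty_lists_le])
  show "inc u \<in> borel_measurable M" if "u \<in> I" for u
    using inc_gaussian(1)[OF that] by (simp add: gaussian_rv_def)
  fix t :: "vertex \<Rightarrow> real"
  have one: "(CLINT \<omega>|M. iexp (t u * inc u \<omega>)) = complex_of_real (exp (- ((t u)\<^sup>2 * level_var (length u)) / 2))"
    if "u \<in> I" for u
  proof -
    have eq: "(\<Sum>w\<in>I. (if w = u then t u else 0) * inc w \<omega>) = t u * inc u \<omega>" for \<omega>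
      using that finite_nonempty_lists_le[of N]
      by (simp add: if_distrib[of "\<lambda>x. x * _"] cong: if_cong)
    have "(\<Sum>w\<in>I. (if w = u then t u else 0)\<^sup>2 * level_var (length w)) = (t u)\<^sup>2 * level_var (length u)"
      using that finite_nonempty_lists_le[of N]
      by (simp add: if_distrib[of "\<lambda>x. x ^ 2 * _"] cong: if_cong)
    then show ?thesis
      using centered_gaussian_rv_char[OF inc_combination(1,2), of "\<lambda>w. if w = u then t u else 0"]
        inc_combination(3)[of "\<lambda>w. if w = u then t u else 0"]
      unfolding eq by simp
  qed
  have "(CLINT \<omega>|M. iexp (\<Sum>u\<in>I. t u * inc u \<omega>)) = complex_of_real (exp (\<Sum>u\<in>I. - ((t u)\<^sup>2 * level_var (length u)) / 2))"
    unfolding centered_gaussian_rv_char[OF inc_combination(1,2)] inc_combination(3)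
    by (simp add: sum_negf sum_divide_distrib)
  also have "\<dots> = (\<Prod>u\<in>I. complex_of_real (exp (- ((t u)\<^sup>2 * level_var (length u)) / 2)))"
    using finite_nonempty_lists_le[of N] by (subst exp_sum) simp_all
  also have "\<dots> = (\<Prod>u\<in>I. CLINT \<omega>|M. iexp (t u * inc u \<omega>))"
    by (intro prod.cong refl one[symmetric])
  finally show "(CLINT \<omega>|M. iexp (\<Sum>u\<in>I. t u * inc u \<omega>)) = (\<Prod>u\<in>I. CLINT \<omega>|M. iexp (t u * inc u \<omega>))" .
qed

sublocale cascade: multiplicative_cascade M \<xi> N "\<lambda>k. \<beta>\<^sup>2 * level_var k"
proof
  show "indep_vars (\<lambda>_. borel) \<xi> I"
    unfolding \<xi>_def[abs_def]
    by (rule indep_vars_compose2[OF indep_inc, where Y="\<lambda>u x. exp (\<beta> * x - \<beta>\<^sup>2 * level_var (length u) / 2)"]) auto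
  show "0 < \<xi> u \<omega>" for u \<omega> by (simp add: \<xi>_def)
  fix u :: vertex and t :: real assume "u \<noteq> []" "length u \<le> N"
  then have u: "u \<in> I" by simp
  have "\<xi> u \<omega> powr t = exp (- (t * \<beta>\<^sup>2 * level_var (length u) / 2)) * exp ((t * \<beta>) * inc u \<omega>)" for \<omega>
    by (simp add: \<xi>_def powr_def algebra_simps flip: exp_add)
  moreover have "exp (t * (t - 1) * (\<beta>\<^sup>2 * level_var (length u)) / 2) =
      exp (- (t * \<beta>\<^sup>2 * level_var (length u) / 2)) * exp ((t * \<beta>)\<^sup>2 * level_var (length u) / 2)"
    by (simp add: algebra_simps power2_eq_square diff_divide_distrib flip: exp_add)
  moreover have "has_bochner_integral M (\<lambda>\<omega>. exp ((t * \<beta>) * inc u \<omega>)) (exp ((t * \<beta>)\<^sup>2 * level_var (length u) / 2))"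
    using centered_gaussian_rv_mgf[OF inc_gaussian(1,2)[OF u], of "t * \<beta>"] inc_gaussian(3)[OF u] by simp
  ultimately show "has_bochner_integral M (\<lambda>\<omega>. \<xi> u \<omega> powr t) (exp (t * (t - 1) * (\<beta>\<^sup>2 * level_var (length u)) / 2))"
    by (simp add: has_bochner_integral_mult_right)
qed

section \<open>The partition function as a cascade\<close>

lemma sum_level_var: "(\<Sum>i<j. level_var (Suc (k + i))) = real N * (A (real (k + j) / real N) - A (real k / real N))"
  by (induction j) (simp_all add: level_var_def algebra_simps)

text \<open>Splitting off the first edge of each path gives an identity for every outcome.
  Subtracting \<open>X u\<close> lets the statement pass to the subtrees of the children; the
  exponential prefactor collects the normalisations of the weights.\<close>

lemma subtree_partition_function:
  "(\<Sum>w | length w = n. exp (\<beta> * (X (u @ w) \<omega> - X u \<omega>))) =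
     2 ^ n * exp (\<beta>\<^sup>2 * (\<Sum>i<n. level_var (Suc (length u + i))) / 2) * cascade.W n u \<omega>"
proof (induction n arbitrary: u)
  case 0
  have "{w :: vertex. length w = 0} = {[]}" by auto
  then show ?case by simp
next
  case (Suc n)
  let ?e = "exp (\<beta>\<^sup>2 * level_var (Suc (length u)) / 2)"
  let ?S = "exp (\<beta>\<^sup>2 * (\<Sum>i<n. level_var (Suc (Suc (length u + i)))) / 2)"
  have child: "(\<Sum>w | length w = n. exp (\<beta> * (X (u @ b # w) \<omega> - X u \<omega>))) = 2 ^ n * ?S * ?e * cascade.Y n (u @ [b]) \<omega>" for b
  proof -
    have "exp (\<beta> * (X (u @ b # w) \<omega> - X u \<omega>)) = exp (\<beta> * (X ((u @ [b]) @ w) \<omega> - X (u @ [b]) \<omega>)) * exp (\<beta> * inc (u @ [b]) \<omega>)" for w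
      by (simp add: inc_def algebra_simps flip: exp_add)
    moreover have "exp (\<beta> * inc (u @ [b]) \<omega>) = ?e * \<xi> (u @ [b]) \<omega>"
      by (simp add: \<xi>_def flip: exp_add)
    ultimately have "(\<Sum>w | length w = n. exp (\<beta> * (X (u @ b # w) \<omega> - X u \<omega>))) =
       (\<Sum>w | length w = n. exp (\<beta> * (X ((u @ [b]) @ w) \<omega> - X (u @ [b]) \<omega>))) * (?e * \<xi> (u @ [b]) \<omega>)"
      by (simp add: sum_distrib_right)
    then show ?thesis unfolding Suc.IH by (simp add: cascade.Y_def mult_ac)
  qed
  have "exp (\<beta>\<^sup>2 * (\<Sum>i<Suc n. level_var (Suc (length u + i))) / 2) = ?S * ?e"
    unfolding sum.lessThan_Suc_shift by (simp add: algebra_simps add_divide_distrib flip: exp_add)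
  then show ?case
    unfolding sum_lists_length_Suc child cascade.W_Suc by (simp add: algebra_simps del: sum.lessThan_Suc)
qed

text \<open>The mean of the partition function, as \<open>expectation_partition_function\<close>
  confirms: there are 2^N leaves, each of variance N A(1) = N.\<close>

definition "Z\<^sub>0 = 2 ^ N * exp (\<beta>\<^sup>2 * real N / 2)"

text \<open>The root has variance N A(0) = 0, so \<open>X []\<close> vanishes almost surely but
  perhaps not everywhere.\<close>

lemma partition_function_AE: "AE \<omega> in M. partition_function X \<beta> N \<omega> = Z\<^sub>0 * cascade.W N [] \<omega>"
proof -
  have root: "[] \<in> binary_tree N" by (simp add: binary_tree_def)
  have "AE \<omega> in M. (X [] \<omega>)\<^sup>2 = 0"
    using integral_nonneg_eq_0_iff_AE[of M "\<lambda>\<omega>. (X [] \<omega>)\<^sup>2"] EXX[OF root root] A0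
      centered_gaussian_rv_square_integrable[OF gaussian_X EX, OF root root]
    by (simp add: power2_eq_square)
  then show ?thesis
  proof (eventually_elim)
    fix \<omega> assume "(X [] \<omega>)\<^sup>2 = 0"
    then have X0: "X [] \<omega> = 0" by simp
    have "(\<Sum>i<N. level_var (Suc i)) = real N"
      using sum_level_var[of 0 N] N A0 A1 by simp
    then show "partition_function X \<beta> N \<omega> = Z\<^sub>0 * cascade.W N [] \<omega>"
      using subtree_partition_function[where n=N and u="[]" and \<omega>=\<omega>] X0 by (simp add: partition_function_def Z\<^sub>0_def)
  qed
qed

lemma measurable_partition_function [measurable]: "partition_function X \<beta> N \<in> borel_measurable M"
  unfolding partition_function_def[abs_def] by (intro borel_measurable_sum) (auto simp: binary_tree_def)

lemma expectation_partition_function: "expectation (partition_function X \<beta> N) = Z\<^sub>0"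
proof -
  have "expectation (partition_function X \<beta> N) = expectation (\<lambda>\<omega>. Z\<^sub>0 * cascade.W N [] \<omega>)"
    by (intro integral_cong_AE partition_function_AE) auto
  then show ?thesis
    using cascade.has_bochner_integral_W[of "[]" N] by (simp add: has_bochner_integral_iff)
qed

lemma partition_function_neg_moment:
  assumes "0 < s"
  shows "integrable M (\<lambda>\<omega>. partition_function X \<beta> N \<omega> powr (- s))"
    and "expectation (\<lambda>\<omega>. partition_function X \<beta> N \<omega> powr (- s)) =
      expectation (\<lambda>\<omega>. cascade.W N [] \<omega> powr (- s)) * expectation (partition_function X \<beta> N) powr (- s)"
proof -
  have Z0: "0 < Z\<^sub>0" by (simp add: Z\<^sub>0_def)
  have ae: "AE \<omega> in M. partition_function X \<beta> N \<omega> powr (- s) = Z\<^sub>0 powr (- s) * cascade.W N [] \<omega> powr (- s)"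
    using partition_function_AE by eventually_elim (simp add: powr_mult Z0 less_imp_le cascade.W_pos)
  have "integrable M (\<lambda>\<omega>. Z\<^sub>0 powr (- s) * cascade.W N [] \<omega> powr (- s))"
    using cascade.integrable_W_neg[OF assms, of "[]" N] by simp
  moreover have "integrable M (\<lambda>\<omega>. partition_function X \<beta> N \<omega> powr (- s)) \<longleftrightarrow>
     integrable M (\<lambda>\<omega>. Z\<^sub>0 powr (- s) * cascade.W N [] \<omega> powr (- s))"
    by (intro integrable_cong_AE ae) auto
  ultimately show "integrable M (\<lambda>\<omega>. partition_function X \<beta> N \<omega> powr (- s))" by simp
  have "expectation (\<lambda>\<omega>. partition_function X \<beta> N \<omega> powr (- s)) =
      expectation (\<lambda>\<omega>. Z\<^sub>0 powr (- s) * cascade.W N [] \<omega> powr (- s))"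
    by (intro integral_cong_AE ae) auto
  then show "expectation (\<lambda>\<omega>. partition_function X \<beta> N \<omega> powr (- s)) =
      expectation (\<lambda>\<omega>. cascade.W N [] \<omega> powr (- s)) * expectation (partition_function X \<beta> N) powr (- s)"
    by (simp add: expectation_partition_function)
qed

end

theorem theorem1p3:
  fixes A :: "real \<Rightarrow> real" and \<beta> s :: real
  assumes "A \<in> {0..1} \<rightarrow> {0..1}"
    and "covariance_profile A"
    and "0 \<le> \<beta>" and "\<beta> < critical_beta A"
    and "0 < s"
  shows "\<exists>(N0::nat) (C::real). 0 < C \<and>
    (\<forall>N\<ge>N0. \<forall>(M::'w measure) X. crem A N M X \<longrightarrow>
       integrable M (\<lambda>\<omega>. partition_function X \<beta> N \<omega> powr (- s)) \<and>
       prob_space.expectation M (\<lambda>\<omega>. partition_function X \<beta> N \<omega> powr (- s))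
         \<le> C * prob_space.expectation M (partition_function X \<beta> N) powr (- s))"
proof -
  define K where "K = right_deriv (concave_hull A) 0"
  have K1: "1 \<le> K"
    unfolding K_def by (rule covariance_profile_right_deriv_ge_1[where K'="right_deriv (concave_hull A) 0 + 1"]) (use assms in auto)
  have A0: "A 0 = 0" and A1: "A 1 = 1" using assms(2) by (auto simp: covariance_profile_def)
  have "\<beta> < sqrt (2 * ln 2 / K)"
    using assms(4) by (simp add: critical_beta_def K_def real_sqrt_divide)
  then have "\<beta>\<^sup>2 < 2 * ln 2 / K"
    using assms(3) K1 power_strict_mono[of \<beta> "sqrt (2 * ln 2 / K)" 2] by simp
  then have \<beta>K: "\<beta>\<^sup>2 * K < 2 * ln 2" using K1 by (simp add: field_simps)
  \<comment> \<open>The midpoint of \<beta>^2 K and 2 ln 2. The gap below it allows K to be enlarged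
    to K'; the gap above it makes the cascade subcritical.\<close>
  define q where "q = (\<beta>\<^sup>2 * K + 2 * ln 2) / 2"
  have q: "0 < q" "q < 2 * ln 2" "\<beta>\<^sup>2 * K < q"
  proof -
    have "0 \<le> \<beta>\<^sup>2 * K" "0 < ln (2::real)" using K1 by auto
    moreover have "2 * q = \<beta>\<^sup>2 * K + 2 * ln 2" by (simp add: q_def)
    ultimately show "0 < q" "q < 2 * ln 2" "\<beta>\<^sup>2 * K < q" using \<beta>K by simp_all
  qed
  \<comment> \<open>Dividing by \<beta>^2 + 1 instead of \<beta>^2 covers \<beta> = 0 and still
    gives \<beta>^2 (K + e) <= q.\<close>
  define e where "e = (q - \<beta>\<^sup>2 * K) / (\<beta>\<^sup>2 + 1)"
  have \<beta>1: "0 < \<beta>\<^sup>2 + 1" by (simp add: add_nonneg_pos)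
  then have e: "0 < e" "(\<beta>\<^sup>2 + 1) * e = q - \<beta>\<^sup>2 * K"
    using q(3) unfolding e_def by (auto intro: divide_pos_pos)
  define K' where "K' = K + e"
  have KK': "K < K'" using e by (simp add: K'_def)
  have K'q: "\<beta>\<^sup>2 * K' \<le> q"
  proof -
    have "\<beta>\<^sup>2 * K' = \<beta>\<^sup>2 * K + (\<beta>\<^sup>2 + 1) * e - e"
      by (simp only: K'_def distrib_left distrib_right)
    then show ?thesis using e by simp
  qed
  obtain \<delta> where \<delta>: "0 < \<delta>" "\<delta> \<le> 1"
    and incr: "\<And>x y. 0 \<le> x \<Longrightarrow> x \<le> \<delta> \<Longrightarrow> x \<le> y \<Longrightarrow> y \<le> 1 \<Longrightarrow> A y - A x \<le> K' * (y - x)"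
    using covariance_profile_increments_le[OF assms(1,2), of K'] KK' by (auto simp: K_def)
  obtain C N0 where C: "\<And>N (M :: 'w measure) \<xi> v u. N0 \<le> N \<Longrightarrow> multiplicative_cascade M \<xi> N v \<Longrightarrow>
       subcritical_variances q (\<beta>\<^sup>2) \<delta> N v \<Longrightarrow> length u = 0 \<Longrightarrow> 0 \<le> N \<Longrightarrow>
       (LINT \<omega>|M. multiplicative_cascade.W \<xi> (N - 0) u \<omega> powr (- s)) \<le> C"
    by (rule bounded_neg_momentsE[OF bounded_neg_moments_all[OF q(1,2) zero_le_power2 \<delta> assms(5)], where k=0]) (erule that)
  show ?thesis
  \<comment> \<open>The maxima with 1 ensure N > 0, as the locale demands because levels are
    rescaled by N, and a positive constant.\<close>
  proof (intro exI[of _ "max 1 N0"] exI[of _ "max 1 C"] conjI allI impI)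
    show "0 < max 1 C" by (simp add: less_max_iff_disj)
  next
    fix N and M :: "'w measure" and X
    assume N_ge: "max 1 N0 \<le> N" and crem: "crem A N M X"
    interpret crem_process A N M X \<beta>
      by standard (use N_ge crem A0 A1 in auto)
    have Npos: "0 < real N" using N_ge by simp
    \<comment> \<open>A block of j levels starting at k has total variance \<beta>^2 N times the
      increment of A over an interval of length j / N. The increment bound gives \<beta>^2 K' j <= q
      j, and values of A in [0,1] give \<beta>^2 N.\<close>
    have var: "subcritical_variances q (\<beta>\<^sup>2) \<delta> N (\<lambda>k. \<beta>\<^sup>2 * level_var k)"
      unfolding subcritical_variances_def
    proof (intro conjI allI impI)
      fix k j :: nat assume kj: "k + j \<le> N"
      have sum: "(\<Sum>i<j. \<beta>\<^sup>2 * level_var (Suc (k + i))) = \<beta>\<^sup>2 * (real N * (A (real (k + j) / real N) - A (real k / real N)))"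
        by (simp only: sum_level_var sum_distrib_left[symmetric])
      have kj': "real k + real j \<le> real N" using kj by linarith
      have x: "0 \<le> real k / real N" "real k / real N \<le> 1" "real k / real N \<le> real (k + j) / real N"
        and y: "0 \<le> real (k + j) / real N" "real (k + j) / real N \<le> 1"
        using kj' Npos by (simp_all add: divide_le_eq_1_pos divide_right_mono)
      then have "real k / real N \<in> {0..1}" "real (k + j) / real N \<in> {0..1}" by simp_all
      then have "A (real k / real N) \<in> {0..1}" "A (real (k + j) / real N) \<in> {0..1}"
        using funcset_mem[OF assms(1)] by blast+
      then have "A (real (k + j) / real N) \<le> 1" "0 \<le> A (real k / real N)"
        by (simp_all only: atLeastAtMost_iff)
      then have "real N * (A (real (k + j) / real N) - A (real k / real N)) \<le> real N * 1"
        by (intro mult_left_mono) auto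
      then show "(\<Sum>i<j. \<beta>\<^sup>2 * level_var (Suc (k + i))) \<le> \<beta>\<^sup>2 * N"
        unfolding sum by (intro mult_left_mono) auto
      assume "real k \<le> \<delta> * N"
      then have "real k / real N \<le> \<delta>" using Npos by (simp add: pos_divide_le_eq)
      then have "A (real (k + j) / real N) - A (real k / real N) \<le> K' * (real (k + j) / real N - real k / real N)"
        using x y by (intro incr)
      then have "real N * (A (real (k + j) / real N) - A (real k / real N)) \<le> K' * j"
      proof -
        assume "A (real (k + j) / real N) - A (real k / real N) \<le> K' * (real (k + j) / real N - real k / real N)"
        then have "real N * (A (real (k + j) / real N) - A (real k / real N))
            \<le> real N * (K' * (real (k + j) / real N - real k / real N))"
          using Npos by (intro mult_left_mono) auto
        also have "real (k + j) / real N - real k / real N = real j / real N"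
          by (simp add: diff_divide_distrib[symmetric])
        also have "real N * (K' * (real j / real N)) = K' * j" using Npos by simp
        finally show ?thesis .
      qed
      then have "(\<Sum>i<j. \<beta>\<^sup>2 * level_var (Suc (k + i))) \<le> \<beta>\<^sup>2 * (K' * j)"
        unfolding sum by (intro mult_left_mono) auto
      also have "\<dots> \<le> q * j"
        unfolding mult.assoc[symmetric] using K'q by (rule mult_right_mono) simp
      finally show "(\<Sum>i<j. \<beta>\<^sup>2 * level_var (Suc (k + i))) \<le> q * j" .
    qed
    show "integrable M (\<lambda>\<omega>. partition_function X \<beta> N \<omega> powr (- s))"
      by (rule partition_function_neg_moment) fact
    have "expectation (\<lambda>\<omega>. cascade.W N [] \<omega> powr (- s)) \<le> C"
      using C[OF _ cascade.multiplicative_cascade_axioms var, of "[]"] N_ge by simp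
    then have "expectation (\<lambda>\<omega>. cascade.W N [] \<omega> powr (- s)) \<le> max 1 C"
      by (rule max.coboundedI2)
    then have "expectation (\<lambda>\<omega>. cascade.W N [] \<omega> powr (- s)) * expectation (partition_function X \<beta> N) powr (- s)
        \<le> max 1 C * expectation (partition_function X \<beta> N) powr (- s)"
      by (rule mult_right_mono) (rule powr_ge_zero)
    then show "expectation (\<lambda>\<omega>. partition_function X \<beta> N \<omega> powr (- s))
        \<le> max 1 C * expectation (partition_function X \<beta> N) powr (- s)"
      by (simp only: partition_function_neg_moment(2)[OF assms(5)])
  qed
qed

end
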